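(* Let $\mu=\mu_1\otimes\cdots\otimes\mu_n$ be the standard Gaussian measure on $\mathbb{R}^n$. Let $f:\mathbb{R}^n\to\mathcal{H}_d$ be such that all of its matrix coefficients are smooth and in $L^2(\mu)$. Then for any $t\in\mathbb{R}_+$, $$\mu\Big(\lambda_{\max}\big(f-\mathbb{E}_\mu f\big)\ge t\Big)\le d\,\exp\bigg(-\frac{t^2}{2v_f+t\sqrt{2v_f}}\bigg),$$ where $v_f=\sup_{(x_1,\dots,x_n)\in\mathbb{R}^n}\big\|\sum_{i=1}^n(\partial_if)^2(x_1,\dots,x_n)\big\|$ and $\partial_if=\frac{\partial f}{\partial x_i}$ is the entrywise partial derivative.
   Context: $\mathcal{H}_d$ is the set of $d\times d$ Hermitian matrices, $\|\cdot\|$ is the operator norm, $\lambda_{\max}$ is the largest eigenvalue. Expectations $\mathbb{E}_\mu f=\int f\,d\mu$ are entrywise, and squares are matrix squares. If $v_f=\infty$ the right-hand side is read as $d$ (trivial bound). *)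

theory Defs
  imports "HOL-Probability.Probability"
begin

definition hermitian :: "complex ^ 'd ^ 'd \<Rightarrow> bool" where
  "hermitian A \<longleftrightarrow> (\<forall>j k. A $ j $ k = cnj (A $ k $ j))"

definition eigenvalue :: "complex ^ 'd ^ 'd \<Rightarrow> complex \<Rightarrow> bool" where
  "eigenvalue A c \<longleftrightarrow> (\<exists>v. v \<noteq> 0 \<and> A *v v = c *s v)"

(* Intended for Hermitian A only, where the set is finite and nonempty. *)
definition lambda_max :: "complex ^ 'd ^ 'd \<Rightarrow> real" where
  "lambda_max A = Max {l. eigenvalue A (complex_of_real l)}"

(* The norm on complex ^ 'd is the Euclidean one; the norm of the type
   complex ^ 'd ^ 'd is the Frobenius norm and not the one wanted. *)
definition op_norm :: "complex ^ 'd ^ 'd \<Rightarrow> real" where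
  "op_norm A = onorm ((*v) A)"

definition std_gaussian :: "(real ^ 'n) measure" where
  "std_gaussian =
     distr (\<Pi>\<^sub>M i\<in>UNIV. density lborel (\<lambda>s. ennreal (std_normal_density s))) borel
       (\<lambda>g. \<chi> i. g i)"

definition partial_deriv ::
    "'n \<Rightarrow> (real ^ 'n \<Rightarrow> 'a::real_normed_vector) \<Rightarrow> real ^ 'n \<Rightarrow> 'a" where
  "partial_deriv i g x = vector_derivative (\<lambda>s. g (x + s *\<^sub>R axis i 1)) (at 0)"

primrec C_k :: "nat \<Rightarrow> (real ^ 'n \<Rightarrow> 'a::real_normed_vector) \<Rightarrow> bool" where
  "C_k 0 g \<longleftrightarrow> continuous_on UNIV g"
| "C_k (Suc k) g \<longleftrightarrow> (\<forall>x. g differentiable (at x)) \<and> (\<forall>i. C_k k (partial_deriv i g))"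

definition smooth :: "(real ^ 'n \<Rightarrow> 'a::real_normed_vector) \<Rightarrow> bool" where
  "smooth g \<longleftrightarrow> (\<forall>k. C_k k g)"

definition in_L2 :: "'b measure \<Rightarrow> ('b \<Rightarrow> complex) \<Rightarrow> bool" where
  "in_L2 M g \<longleftrightarrow> g \<in> borel_measurable M \<and> integrable M (\<lambda>x. (cmod (g x))\<^sup>2)"

definition mat_expectation :: "'b measure \<Rightarrow> ('b \<Rightarrow> complex ^ 'd ^ 'd) \<Rightarrow> complex ^ 'd ^ 'd" where
  "mat_expectation M f = (\<chi> j k. \<integral>x. f x $ j $ k \<partial>M)"

definition mat_partial_deriv ::
    "'n \<Rightarrow> (real ^ 'n \<Rightarrow> complex ^ 'd ^ 'd) \<Rightarrow> real ^ 'n \<Rightarrow> complex ^ 'd ^ 'd" where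
  "mat_partial_deriv i f x = (\<chi> j k. partial_deriv i (\<lambda>y. f y $ j $ k) x)"

definition variance_param :: "(real ^ 'n \<Rightarrow> complex ^ 'd ^ 'd) \<Rightarrow> ereal" where
  "variance_param f =
     (SUP x. ereal (op_norm (\<Sum>i\<in>UNIV. mat_partial_deriv i f x ** mat_partial_deriv i f x)))"

(* d exp (- t^2 / (2 v + t sqrt (2 v))) for t \<ge> 0. For v = \<infinity> this is the trivial bound d. For v = 0
   the fraction is read as its limit, t^2 / 0 = \<infinity> for t > 0, so the bound is 0 there, and as 0 for
   t = 0; the HOL value t^2 / 0 = 0 would weaken the bound to d. *)
definition tail_bound :: "nat \<Rightarrow> ereal \<Rightarrow> real \<Rightarrow> real" where
  "tail_bound d v t =
     (if v = \<infinity> then real d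
      else if v = 0 then (if t > 0 then 0 else real d)
      else real d * exp (- (t\<^sup>2 / (2 * real_of_ereal v + t * sqrt (2 * real_of_ereal v)))))"

end

theory Submission
  imports Defs
begin

text \<open>For \<open>E f = 0\<close>, put \<open>L(\<theta>) = E tr exp(\<theta> f)\<close>, so that \<open>L'(\<theta>) = E tr (f exp(\<theta> f))\<close>. Let \<open>(X, Y)\<close> be a
  pair of independent standard Gaussian vectors. Rotating the argument of \<open>f\<close> in
  \<open>E tr (f(cos \<phi> X + sin \<phi> Y) exp(\<theta> f(X)))\<close> from \<open>\<phi> = 0\<close> to \<open>\<phi> = \<pi>/2\<close> and integrating by parts in the
  orthogonal direction expresses \<open>L'(\<theta>)\<close> as an average over \<open>\<phi>\<close> of the expectations
  \<open>\<Sum>\<^sub>i E tr (\<partial>\<^sub>i f(X) \<partial>\<^sub>i exp(\<theta> f)(Z))\<close> with \<open>Z = cos \<phi> X - sin \<phi> Y\<close>. By Duhamel's formula for the derivative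
  of the exponential, Cauchy--Schwarz, and convexity of \<open>u \<mapsto> tr (A exp(u F) A exp((1 - u) F))\<close>, each of
  them is at most \<open>\<theta> v L(\<theta>)\<close>. Hence \<open>L(\<theta>) \<le> d exp(\<theta>\<^sup>2 v / 2)\<close>, and Markov's inequality yields the
  subgaussian tail \<open>d exp(- t\<^sup>2 / (2 v))\<close>, which is stronger than the claim.\<close>

subsection \<open>Gaussian integration by parts and covariance\<close>

text \<open>Rotation decouples the two gradients: one is evaluated at X, the other at Z, and the
  pointwise estimate must hold for arbitrary unrelated points. It does, because the gradient at X
  enters only through a sum of squares that \<open>v\<close> bounds uniformly. What remains is a
  function of Z alone, and Z has the law of X, so a closed differential inequality for L results.
  All exchanges of limit and integral rest on one growth class. A finite \<open>v\<close> makes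
  \<open>f\<close> Lipschitz, so \<open>f\<close> grows at most linearly and exp(\<theta> f) at most
  exponentially in the norm, and a Gaussian vector has all exponential moments of its norm. Complex
  d-space is treated as a real Euclidean space of dimension 2d. The trace used throughout is the
  real one, twice the complex trace, so that L(0) = 2d; the factor 2 cancels in Markov's inequality
  because every eigenvalue has a real eigenspace of dimension at least 2.\<close>

lemma has_real_derivative_integral:
  fixes h h' :: "real \<Rightarrow> 'x \<Rightarrow> real"
  assumes r: "r > 0"
    and int: "\<And>s. \<bar>s - s0\<bar> < r \<Longrightarrow> integrable M (h s)"
    and der: "\<And>s x. \<bar>s - s0\<bar> < r \<Longrightarrow> ((\<lambda>s. h s x) has_real_derivative h' s x) (at s)"
    and bound: "\<And>s x. \<bar>s - s0\<bar> < r \<Longrightarrow> \<bar>h' s x\<bar> \<le> w x"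
    and w: "integrable M w"
  shows "((\<lambda>s. \<integral>x. h s x \<partial>M) has_real_derivative (\<integral>x. h' s0 x \<partial>M)) (at s0)"
  unfolding has_field_derivative_iff tendsto_at_iff_sequentially
proof (intro allI impI)
  fix X :: "nat \<Rightarrow> real"
  assume X: "\<forall>i. X i \<in> UNIV - {s0}" and lim: "X \<longlonglongrightarrow> s0"
  have "\<forall>\<^sub>F i in sequentially. \<bar>X i - s0\<bar> < r"
    using tendstoD[OF lim r] by (simp add: dist_real_def)
  \<comment> \<open>The hypotheses hold only within distance \<open>r\<close> of \<open>s0\<close>,
    so the first \<open>N\<close> terms of the sequence are dropped and restored at the end.\<close>
  then obtain N where N: "\<And>i. i \<ge> N \<Longrightarrow> \<bar>X i - s0\<bar> < r"
    by (auto simp: eventually_sequentially)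
  define q where "q i x = (h (X (i + N)) x - h s0 x) / (X (i + N) - s0)" for i x
  have limN: "(\<lambda>i. X (i + N)) \<longlonglongrightarrow> s0"
    using lim by (rule LIMSEQ_ignore_initial_segment)
  have q_lim: "(\<lambda>i. q i x) \<longlonglongrightarrow> h' s0 x" for x
  proof -
    have "((\<lambda>s. (h s x - h s0 x) / (s - s0)) \<longlongrightarrow> h' s0 x) (at s0)"
      using der[of s0 x] r by (simp add: has_field_derivative_iff)
    then show ?thesis
      unfolding tendsto_at_iff_sequentially q_def using X limN by (auto simp: o_def)
  qed
  have q_int: "integrable M (q i)" for i
    unfolding q_def using int[OF N[of "i + N"]] int[of s0] r by simp
  \<comment> \<open>The mean value theorem turns the bound on the derivative into one on the
    difference quotients, uniform in \<open>i\<close>.\<close>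
  have q_bound: "\<bar>q i x\<bar> \<le> w x" for i x
  proof -
    have "\<bar>h (X (i + N)) x - h s0 x\<bar> \<le> w x * \<bar>X (i + N) - s0\<bar>"
    proof -
      have "norm (h (X (i + N)) x - h s0 x) \<le> w x * norm (X (i + N) - s0)"
      proof (rule field_differentiable_bound[of "ball s0 r" "\<lambda>s. h s x" "\<lambda>s. h' s x"])
        show "((\<lambda>s. h s x) has_real_derivative h' z x) (at z within ball s0 r)" if "z \<in> ball s0 r" for z
          using that der[of z x]
          by (auto simp: dist_real_def abs_minus_commute intro: has_field_derivative_at_within)
        show "norm (h' z x) \<le> w x" if "z \<in> ball s0 r" for z
          using that bound[of z x] by (auto simp: dist_real_def abs_minus_commute)
        show "X (i + N) \<in> ball s0 r" "s0 \<in> ball s0 r"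
          using N[of "i + N"] r by (auto simp: dist_real_def abs_minus_commute)
      qed simp
      then show ?thesis by simp
    qed
    moreover have "X (i + N) - s0 \<noteq> 0" using X by auto
    ultimately show ?thesis by (simp add: q_def abs_divide divide_le_eq)
  qed
  \<comment> \<open>Measurability of the derivative comes for free: it is a pointwise limit of
    measurable quotients.\<close>
  have h'_meas: "h' s0 \<in> borel_measurable M"
    using q_lim borel_measurable_integrable[OF q_int] by (rule borel_measurable_LIMSEQ_real)
  have "(\<lambda>i. \<integral>x. q i x \<partial>M) \<longlonglongrightarrow> (\<integral>x. h' s0 x \<partial>M)"
    using h'_meas borel_measurable_integrable[OF q_int] w q_lim q_bound
    by (intro integral_dominated_convergence[where w = w]) auto
  also have "(\<lambda>i. \<integral>x. q i x \<partial>M)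
      = (\<lambda>i. ((\<integral>x. h (X (i + N)) x \<partial>M) - (\<integral>x. h s0 x \<partial>M)) / (X (i + N) - s0))"
    unfolding q_def using int[OF N] int[of s0] r by (simp add: fun_eq_iff)
  finally show "((\<lambda>s. ((\<integral>x. h s x \<partial>M) - (\<integral>x. h s0 x \<partial>M)) / (s - s0)) \<circ> X) \<longlonglongrightarrow> (\<integral>x. h' s0 x \<partial>M)"
    unfolding o_def by (rule LIMSEQ_offset)
qed

section \<open>Functions of at most exponential growth\<close>

text \<open>Closed under sums, products and linear substitutions, and its Borel members are Gaussian
  integrable (\<open>integrable_gauss\<close>), so integrability goals are settled by the shape of
  the integrand. Nonnegative constants make the bound monotone in \<open>norm x\<close>.\<close>

definition exp_bdd :: "('a::real_normed_vector \<Rightarrow> 'b::real_normed_vector) \<Rightarrow> bool" where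
  "exp_bdd h \<longleftrightarrow> (\<exists>C c. 0 \<le> C \<and> 0 \<le> c \<and> (\<forall>x. norm (h x) \<le> C * exp (c * norm x)))"

lemma exp_bddI:
  assumes "\<And>x. norm (h x) \<le> C * exp (c * norm x)"
  shows "exp_bdd h"
  unfolding exp_bdd_def
proof (rule exI[of _ "\<bar>C\<bar>"], rule exI[of _ "\<bar>c\<bar>"], intro conjI allI)
  fix x
  have "norm (h x) \<le> C * exp (c * norm x)" by (rule assms)
  also have "\<dots> \<le> \<bar>C\<bar> * exp (\<bar>c\<bar> * norm x)"
    by (intro mult_mono) (auto intro!: mult_right_mono)
  finally show "norm (h x) \<le> \<bar>C\<bar> * exp (\<bar>c\<bar> * norm x)" .
qed auto

lemma exp_bddE:
  assumes "exp_bdd h"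
  obtains C c where "0 \<le> C" "0 \<le> c" "\<And>x. norm (h x) \<le> C * exp (c * norm x)"
  using assms by (auto simp: exp_bdd_def)

lemma exp_bdd_mono: "exp_bdd g \<Longrightarrow> (\<And>x. norm (h x) \<le> norm (g x)) \<Longrightarrow> exp_bdd h"
  unfolding exp_bdd_def by (meson order_trans)

lemma exp_bdd_const: "exp_bdd (\<lambda>_. c)"
  by (rule exp_bddI[of _ "norm c" 0]) simp

lemma exp_bdd_linear:
  assumes "bounded_linear f" shows "exp_bdd f"
proof -
  obtain K where K: "K \<ge> 0" "\<And>x. norm (f x) \<le> norm x * K"
    using bounded_linear.nonneg_bounded[OF assms] by blast
  have "norm (f x) \<le> K * exp (1 * norm x)" for x
  proof -
    have "norm x \<le> exp (norm x)" using exp_ge_add_one_self[of "norm x"] by linarith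
    then have "norm x * K \<le> exp (norm x) * K" using K(1) by (rule mult_right_mono)
    then show ?thesis using K(2)[of x] by (simp add: mult.commute)
  qed
  then show ?thesis by (rule exp_bddI)
qed

lemma exp_bdd_compose:
  assumes "exp_bdd h" "bounded_linear T" shows "exp_bdd (\<lambda>x. h (T x))"
proof -
  obtain C c where C: "0 \<le> C" "0 \<le> c" "\<And>x. norm (h x) \<le> C * exp (c * norm x)"
    using exp_bddE[OF assms(1)] by blast
  obtain K where K: "K \<ge> 0" "\<And>x. norm (T x) \<le> norm x * K"
    using bounded_linear.nonneg_bounded[OF assms(2)] by blast
  have "norm (h (T x)) \<le> C * exp ((c * K) * norm x)" for x
  proof -
    have "norm (h (T x)) \<le> C * exp (c * norm (T x))" by (rule C)
    also have "\<dots> \<le> C * exp ((c * K) * norm x)"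
      using mult_left_mono[OF K(2)[of x] C(2)] C(1) by (intro mult_left_mono) (auto simp: ac_simps)
    finally show ?thesis .
  qed
  then show ?thesis by (rule exp_bddI)
qed

lemma exp_bdd_mult:
  fixes g h :: "_ \<Rightarrow> real"
  assumes "exp_bdd g" "exp_bdd h" shows "exp_bdd (\<lambda>x. g x * h x)"
proof -
  obtain C c where C: "0 \<le> C" "0 \<le> c" "\<And>x. norm (g x) \<le> C * exp (c * norm x)"
    using exp_bddE[OF assms(1)] by blast
  obtain D d where D: "0 \<le> D" "0 \<le> d" "\<And>x. norm (h x) \<le> D * exp (d * norm x)"
    using exp_bddE[OF assms(2)] by blast
  have "norm (g x * h x) \<le> (C * D) * exp ((c + d) * norm x)" for x
  proof -
    have "norm (g x * h x) \<le> (C * exp (c * norm x)) * (D * exp (d * norm x))"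
      unfolding norm_mult using C D by (intro mult_mono) auto
    then show ?thesis by (simp add: exp_add algebra_simps)
  qed
  then show ?thesis by (rule exp_bddI)
qed

lemma exp_bdd_add:
  assumes "exp_bdd g" "exp_bdd h" shows "exp_bdd (\<lambda>x. g x + h x)"
proof -
  obtain C c where C: "0 \<le> C" "0 \<le> c" "\<And>x. norm (g x) \<le> C * exp (c * norm x)"
    using exp_bddE[OF assms(1)] by blast
  obtain D d where D: "0 \<le> D" "0 \<le> d" "\<And>x. norm (h x) \<le> D * exp (d * norm x)"
    using exp_bddE[OF assms(2)] by blast
  have "norm (g x + h x) \<le> (C + D) * exp ((c + d) * norm x)" for x
  proof -
    have "exp (c * norm x) \<le> exp ((c + d) * norm x)" "exp (d * norm x) \<le> exp ((c + d) * norm x)"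
      using C D by (auto intro!: mult_right_mono)
    then have "C * exp (c * norm x) + D * exp (d * norm x) \<le> (C + D) * exp ((c + d) * norm x)"
      unfolding distrib_right using C D by (intro add_mono mult_left_mono) auto
    then show ?thesis using norm_triangle_ineq[of "g x" "h x"] C(3)[of x] D(3)[of x] by linarith
  qed
  then show ?thesis by (rule exp_bddI)
qed

lemma exp_bdd_sum: "(\<And>i. i \<in> I \<Longrightarrow> exp_bdd (h i)) \<Longrightarrow> exp_bdd (\<lambda>x. \<Sum>i\<in>I. h i x)"
  by (induction I rule: infinite_finite_induct) (auto intro: exp_bdd_const exp_bdd_add)

lemma exp_bdd_exp_norm: "exp_bdd (\<lambda>x. C * exp (c * norm x) :: real)"
  by (rule exp_bddI[of _ "\<bar>C\<bar>" c]) (simp add: abs_mult)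

section \<open>The standard Gaussian measure on a Euclidean space\<close>

definition gauss_density :: "'a::euclidean_space \<Rightarrow> real" where
  "gauss_density x = (\<Prod>b\<in>Basis. std_normal_density (x \<bullet> b))"

text \<open>Available on every Euclidean space, in particular on products, so that an independent
  pair is governed by the same constant (\<open>gauss_pair\<close>). The agreement with the measure
  of the theorem is \<open>std_gaussian_eq_gauss\<close>.\<close>

definition gauss :: "'a::euclidean_space measure" where
  "gauss = density lborel (\<lambda>x. ennreal (gauss_density x))"

lemma sets_gauss[simp, measurable_cong]: "sets gauss = sets borel"
  by (simp add: gauss_def)

lemma space_gauss[simp]: "space gauss = UNIV"
  by (simp add: gauss_def)

lemma gauss_density_nonneg[simp]: "gauss_density x \<ge> 0"
  unfolding gauss_density_def by (intro prod_nonneg) auto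

lemma borel_measurable_gauss_density[measurable]: "gauss_density \<in> borel_measurable borel"
  unfolding gauss_density_def by measurable

lemma gauss_density_eq:
  "gauss_density x = (1 / sqrt (2 * pi)) ^ DIM('a) * exp (- (norm (x::'a::euclidean_space))\<^sup>2 / 2)"
proof -
  have "gauss_density x = (1 / sqrt (2 * pi)) ^ DIM('a) * (\<Prod>b\<in>Basis. exp (- (x \<bullet> b)\<^sup>2 / 2))"
    unfolding gauss_density_def std_normal_density_def prod.distrib by simp
  also have "(\<Prod>b\<in>Basis. exp (- (x \<bullet> b)\<^sup>2 / 2)) = exp (\<Sum>b\<in>Basis. - (x \<bullet> b)\<^sup>2 / 2)"
    by (rule exp_sum[symmetric]) simp
  also have "(\<Sum>b\<in>Basis. - (x \<bullet> b)\<^sup>2 / 2) = - (norm x)\<^sup>2 / 2"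
    unfolding power2_norm_eq_inner euclidean_inner[of x x]
    by (simp add: sum_negf sum_divide_distrib power2_eq_square)
  finally show ?thesis .
qed

text \<open>Independence of the coordinates. It yields the total mass, the exponential moments and
  the measure of boxes.\<close>

lemma nn_integral_gauss_prod:
  assumes [measurable]: "\<And>b. b \<in> Basis \<Longrightarrow> f b \<in> borel_measurable borel"
  shows "(\<integral>\<^sup>+x. (\<Prod>b\<in>Basis. f b (x \<bullet> b)) \<partial>(gauss :: 'a::euclidean_space measure))
    = (\<Prod>b\<in>(Basis :: 'a set). \<integral>\<^sup>+s. f b s \<partial>density lborel (\<lambda>s. ennreal (std_normal_density s)))"
proof -
  have "(\<integral>\<^sup>+x. (\<Prod>b\<in>Basis. f b (x \<bullet> b)) \<partial>(gauss :: 'a measure))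
    = (\<integral>\<^sup>+x. (\<Prod>b\<in>(Basis :: 'a set). ennreal (std_normal_density (x \<bullet> b)) * f b (x \<bullet> b)) \<partial>lborel)"
    unfolding gauss_def gauss_density_def
    by (subst nn_integral_density) (auto simp: prod.distrib prod_ennreal)
  also have "\<dots> = (\<Prod>b\<in>(Basis :: 'a set). \<integral>\<^sup>+s. ennreal (std_normal_density s) * f b s \<partial>lborel)"
    by (rule nn_integral_lborel_prod[where f = "\<lambda>b s. ennreal (std_normal_density s) * f b s"]) auto
  also have "\<dots> = (\<Prod>b\<in>(Basis :: 'a set). \<integral>\<^sup>+s. f b s \<partial>density lborel (\<lambda>s. ennreal (std_normal_density s)))"
    by (intro prod.cong refl, subst nn_integral_density) auto
  finally show ?thesis .
qed

interpretation gauss: prob_space "gauss :: 'a::euclidean_space measure"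
proof
  have "emeasure (density lborel (\<lambda>s. ennreal (std_normal_density s))) UNIV = 1"
    using prob_space.emeasure_space_1[OF prob_space_normal_density[of 1 0]] by simp
  then have "(\<integral>\<^sup>+x. 1 \<partial>(gauss :: 'a measure)) = 1"
    using nn_integral_gauss_prod[of "\<lambda>(_ :: 'a) _. 1"] by simp
  then show "emeasure gauss (space (gauss :: 'a measure)) = 1" by simp
qed

lemma nn_integral_std_normal_exp:
  "(\<integral>\<^sup>+s. ennreal (exp (c * s)) \<partial>density lborel (\<lambda>s. ennreal (std_normal_density s))) = ennreal (exp (c\<^sup>2 / 2))"
proof -
  \<comment> \<open>Completing the square: the exponential weight moves the mean of the normal
    density to \<open>c\<close>.\<close>
  have "std_normal_density s * exp (c * s) = exp (c\<^sup>2 / 2) * normal_density c 1 s" for s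
    by (simp add: normal_density_def exp_add[symmetric] power2_eq_square field_simps)
  then have "(\<integral>\<^sup>+s. ennreal (exp (c * s)) \<partial>density lborel (\<lambda>s. ennreal (std_normal_density s)))
    = (\<integral>\<^sup>+s. ennreal (exp (c\<^sup>2 / 2)) * ennreal (normal_density c 1 s) \<partial>lborel)"
    by (subst nn_integral_density) (auto simp: ennreal_mult[symmetric])
  also have "\<dots> = ennreal (exp (c\<^sup>2 / 2)) * (\<integral>\<^sup>+s. ennreal (normal_density c 1 s) \<partial>lborel)"
    by (rule nn_integral_cmult) auto
  also have "(\<integral>\<^sup>+s. ennreal (normal_density c 1 s) \<partial>lborel) = 1"
    by (subst nn_integral_eq_integral) auto
  finally show ?thesis by simp
qed

lemma integrable_gauss_exp_norm: "integrable gauss (\<lambda>x::'a::euclidean_space. exp (c * norm x))"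
proof (rule integrableI_nonneg)
  define k where "k = \<bar>c\<bar>"
  \<comment> \<open>Passing to the l1 norm makes the exponential a product over coordinates, and
    exp(k|s|) \<le> exp(k s) + exp(- k s) removes the absolute values.\<close>
  have le: "exp (c * norm x) \<le> (\<Prod>b\<in>Basis. exp (k * (x \<bullet> b)) + exp (- k * (x \<bullet> b)))" for x :: 'a
  proof -
    have "c * norm x \<le> k * norm x" by (simp add: k_def mult_right_mono)
    also have "\<dots> \<le> k * (\<Sum>b\<in>Basis. \<bar>x \<bullet> b\<bar>)"
      by (intro mult_left_mono norm_le_l1) (simp add: k_def)
    finally have "exp (c * norm x) \<le> (\<Prod>b\<in>Basis. exp (k * \<bar>x \<bullet> b\<bar>))"
      by (simp add: exp_sum[symmetric] sum_distrib_left)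
    also have "\<dots> \<le> (\<Prod>b\<in>Basis. exp (k * (x \<bullet> b)) + exp (- k * (x \<bullet> b)))"
      by (intro prod_mono) (auto simp: abs_if)
    finally show ?thesis .
  qed
  have "(\<integral>\<^sup>+x. ennreal (exp (c * norm x)) \<partial>(gauss :: 'a measure))
    \<le> (\<integral>\<^sup>+x. (\<Prod>b\<in>(Basis::'a set). ennreal (exp (k * (x \<bullet> b))) + ennreal (exp (- k * (x \<bullet> b)))) \<partial>gauss)"
    by (intro nn_integral_mono)
       (use le in \<open>auto simp: prod_ennreal ennreal_plus[symmetric] simp del: ennreal_plus intro!: ennreal_leI\<close>)
  also have "\<dots> = (\<Prod>b\<in>(Basis::'a set). ennreal (exp (k\<^sup>2 / 2)) + ennreal (exp (k\<^sup>2 / 2)))"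
    by (subst nn_integral_gauss_prod, simp, intro prod.cong refl, subst nn_integral_add)
       (auto simp: nn_integral_std_normal_exp simp flip: minus_mult_left
         simp del: ennreal_plus intro!: arg_cong2[of _ _ _ _ "(+)"]
         nn_integral_std_normal_exp[of "-k", simplified])
  also have "\<dots> < \<infinity>"
    by (simp add: ennreal_plus[symmetric] ennreal_power del: ennreal_plus)
  finally show "(\<integral>\<^sup>+x. ennreal (exp (c * norm x)) \<partial>(gauss :: 'a measure)) < \<infinity>" .
qed auto

lemma integrable_gauss:
  fixes h :: "'a::euclidean_space \<Rightarrow> 'b::{banach, second_countable_topology}"
  assumes "exp_bdd h" and "h \<in> borel_measurable borel"
  shows "integrable gauss h"
proof -
  obtain C c where C: "0 \<le> C" "0 \<le> c" "\<And>x. norm (h x) \<le> C * exp (c * norm x)"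
    using exp_bddE[OF assms(1)] by blast
  show ?thesis
  proof (rule Bochner_Integration.integrable_bound)
    show "integrable gauss (\<lambda>x::'a. C * exp (c * norm x))"
      by (intro integrable_mult_right integrable_gauss_exp_norm)
    show "AE x in gauss. norm (h x) \<le> norm (C * exp (c * norm x))"
      using C by simp
  qed (use assms(2) in simp)
qed

lemma gauss_density_Pair:
  "gauss_density (x :: 'a::euclidean_space, y :: 'b::euclidean_space) = gauss_density x * gauss_density y"
  by (simp add: gauss_density_eq norm_Pair power_add exp_add[symmetric] add_divide_distrib)

lemma gauss_pair:
  "(gauss :: 'a::euclidean_space measure) \<Otimes>\<^sub>M (gauss :: 'b::euclidean_space measure) = gauss"
proof -
  have "(gauss :: 'a measure) \<Otimes>\<^sub>M (gauss :: 'b measure)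
    = density (lborel \<Otimes>\<^sub>M lborel) (\<lambda>(x, y). ennreal (gauss_density x) * ennreal (gauss_density y))"
    unfolding gauss_def
    by (intro pair_measure_density)
       (auto simp flip: gauss_def intro: gauss.sigma_finite_measure_axioms lborel.sigma_finite_measure_axioms)
  also have "(\<lambda>(x :: 'a, y :: 'b). ennreal (gauss_density x) * ennreal (gauss_density y))
      = (\<lambda>p. ennreal (gauss_density p))"
    by (auto simp: fun_eq_iff gauss_density_Pair ennreal_mult)
  finally show ?thesis
    by (simp add: lborel_prod gauss_def)
qed

section \<open>Rotation invariance\<close>

text \<open>With one component fixed, a shear is a translation of the other, so Fubini reduces the
  claim to translation invariance.\<close>

lemma nn_integral_lborel_shear:
  fixes h :: "'a::euclidean_space \<times> 'a \<Rightarrow> ennreal"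
  assumes [measurable]: "h \<in> borel_measurable borel"
  shows "(\<integral>\<^sup>+p. h (fst p + a *\<^sub>R snd p, snd p) \<partial>lborel) = (\<integral>\<^sup>+p. h p \<partial>lborel)"
    and "(\<integral>\<^sup>+p. h (fst p, snd p + a *\<^sub>R fst p) \<partial>lborel) = (\<integral>\<^sup>+p. h p \<partial>lborel)"
proof -
  have trans: "(\<integral>\<^sup>+x. k (x + c) \<partial>lborel) = (\<integral>\<^sup>+x. k x \<partial>lborel)"
    if [measurable]: "k \<in> borel_measurable borel" for k :: "'a \<Rightarrow> ennreal" and c
  proof -
    have "(\<integral>\<^sup>+x. k x \<partial>lborel) = (\<integral>\<^sup>+x. k x \<partial>distr lborel borel ((+) c))"
      by (simp add: lborel_distr_plus)
    also have "\<dots> = (\<integral>\<^sup>+x. k (c + x) \<partial>lborel)"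
      by (subst nn_integral_distr) auto
    finally show ?thesis by (simp add: add.commute)
  qed
  have [measurable]: "h \<in> borel_measurable (lborel \<Otimes>\<^sub>M lborel)"
    by (simp add: lborel_prod)
  have "(\<integral>\<^sup>+p. h (fst p + a *\<^sub>R snd p, snd p) \<partial>(lborel \<Otimes>\<^sub>M lborel))
      = (\<integral>\<^sup>+y. \<integral>\<^sup>+x. h (x + a *\<^sub>R y, y) \<partial>lborel \<partial>lborel)"
    by (subst lborel_pair.nn_integral_snd[symmetric]) auto
  also have "\<dots> = (\<integral>\<^sup>+y. \<integral>\<^sup>+x. h (x, y) \<partial>lborel \<partial>lborel)"
    by (intro nn_integral_cong trans) auto
  also have "\<dots> = (\<integral>\<^sup>+p. h p \<partial>(lborel \<Otimes>\<^sub>M lborel))"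
    by (subst lborel_pair.nn_integral_snd[symmetric]) auto
  finally show "(\<integral>\<^sup>+p. h (fst p + a *\<^sub>R snd p, snd p) \<partial>lborel) = (\<integral>\<^sup>+p. h p \<partial>lborel)"
    by (simp add: lborel_prod)
  have "(\<integral>\<^sup>+p. h (fst p, snd p + a *\<^sub>R fst p) \<partial>(lborel \<Otimes>\<^sub>M lborel))
      = (\<integral>\<^sup>+x. \<integral>\<^sup>+y. h (x, y + a *\<^sub>R x) \<partial>lborel \<partial>lborel)"
    by (subst lborel.nn_integral_fst[symmetric]) auto
  also have "\<dots> = (\<integral>\<^sup>+x. \<integral>\<^sup>+y. h (x, y) \<partial>lborel \<partial>lborel)"
    by (intro nn_integral_cong trans) auto
  also have "\<dots> = (\<integral>\<^sup>+p. h p \<partial>(lborel \<Otimes>\<^sub>M lborel))"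
    by (subst lborel.nn_integral_fst[symmetric]) auto
  finally show "(\<integral>\<^sup>+p. h (fst p, snd p + a *\<^sub>R fst p) \<partial>lborel) = (\<integral>\<^sup>+p. h p \<partial>lborel)"
    by (simp add: lborel_prod)
qed

text \<open>For \<open>c\<close> = cos \<phi> and \<open>s\<close> = sin \<phi> the second component
  is the derivative of the first with respect to \<phi>.\<close>

definition rot :: "real \<Rightarrow> real \<Rightarrow> 'a::real_vector \<times> 'a \<Rightarrow> 'a \<times> 'a" where
  "rot c s p = (c *\<^sub>R fst p + s *\<^sub>R snd p, c *\<^sub>R snd p - s *\<^sub>R fst p)"

lemma continuous_rot: "continuous_on UNIV (rot c s :: 'a::real_normed_vector \<times> 'a \<Rightarrow> _)"
  unfolding rot_def by (intro continuous_intros)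

lemma borel_measurable_rot[measurable]:
  "(rot c s :: 'a::euclidean_space \<times> 'a \<Rightarrow> _) \<in> borel_measurable borel"
  by (intro borel_measurable_continuous_onI continuous_rot)

text \<open>A rotation is a product of three shears.\<close>

lemma nn_integral_lborel_rot:
  fixes h :: "'a::euclidean_space \<times> 'a \<Rightarrow> ennreal"
  assumes [measurable]: "h \<in> borel_measurable borel" and cs: "c\<^sup>2 + s\<^sup>2 = 1" "c \<noteq> -1"
  shows "(\<integral>\<^sup>+p. h (rot c s p) \<partial>lborel) = (\<integral>\<^sup>+p. h p \<partial>lborel)"
proof -
  \<comment> \<open>This is tan(\<phi>/2); the shears have parameters \<open>a\<close>,
    \<open>- s\<close>, \<open>a\<close>. The half turn \<open>c = -1\<close> is excluded because
    the tangent has a pole there.\<close>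
  define a where "a = s / (1 + c)"
  have ne: "1 + c \<noteq> 0" using cs(2) by linarith
  have as: "1 - a * s = c"
  proof -
    have "s * s = (1 + c) * (1 - c)" using cs(1) by (simp add: power2_eq_square algebra_simps)
    then show ?thesis using ne unfolding a_def by (simp add: field_simps)
  qed
  have "a * c + a = a * (1 + c)" by (simp add: algebra_simps)
  then have ac: "a * c + a = s" using ne by (simp add: a_def)
  define h1 where "h1 p = h (fst p + a *\<^sub>R snd p, snd p)" for p
  define h2 where "h2 p = h1 (fst p, snd p + (- s) *\<^sub>R fst p)" for p
  have [measurable]: "h1 \<in> borel_measurable borel"
  proof -
    have "(\<lambda>p. (fst p + a *\<^sub>R snd p, snd p)) \<in> borel_measurable (borel :: ('a \<times> 'a) measure)"
      by (intro borel_measurable_continuous_onI continuous_intros)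
    from measurable_compose[OF this assms(1)] show ?thesis by (simp add: h1_def[abs_def])
  qed
  have [measurable]: "h2 \<in> borel_measurable borel"
  proof -
    have "(\<lambda>p. (fst p, snd p + (- s) *\<^sub>R fst p)) \<in> borel_measurable (borel :: ('a \<times> 'a) measure)"
      by (intro borel_measurable_continuous_onI continuous_intros)
    from measurable_compose[OF this \<open>h1 \<in> _\<close>] show ?thesis by (simp add: h2_def[abs_def])
  qed
  have "h (rot c s p) = h2 (fst p + a *\<^sub>R snd p, snd p)" for p
  proof -
    have 1: "snd p - s *\<^sub>R (fst p + a *\<^sub>R snd p) = c *\<^sub>R snd p - s *\<^sub>R fst p"
      unfolding as[symmetric] by (simp add: algebra_simps)
    have 2: "fst p + a *\<^sub>R snd p + a *\<^sub>R (c *\<^sub>R snd p - s *\<^sub>R fst p)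
        = (1 - a * s) *\<^sub>R fst p + (a * c + a) *\<^sub>R snd p"
      by (simp add: algebra_simps)
    show ?thesis
      unfolding h2_def h1_def rot_def using 1 2 by (simp add: as ac)
  qed
  then have "(\<integral>\<^sup>+p. h (rot c s p) \<partial>lborel) = (\<integral>\<^sup>+p. h2 p \<partial>lborel)"
    using nn_integral_lborel_shear(1)[of h2 a] by simp
  also have "\<dots> = (\<integral>\<^sup>+p. h1 p \<partial>lborel)"
    unfolding h2_def by (rule nn_integral_lborel_shear(2)) simp
  also have "\<dots> = (\<integral>\<^sup>+p. h p \<partial>lborel)"
    unfolding h1_def by (rule nn_integral_lborel_shear(1)) simp
  finally show ?thesis .
qed

lemma norm_rot:
  fixes p :: "'a::real_inner \<times> 'a"
  assumes "c\<^sup>2 + s\<^sup>2 = 1" shows "norm (rot c s p) = norm p"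
proof -
  have "(norm (rot c s p))\<^sup>2
      = (norm (c *\<^sub>R fst p + s *\<^sub>R snd p))\<^sup>2 + (norm (c *\<^sub>R snd p - s *\<^sub>R fst p))\<^sup>2"
    by (simp add: rot_def norm_Pair)
  also have "\<dots> = (c\<^sup>2 + s\<^sup>2) * (norm (fst p))\<^sup>2 + (c\<^sup>2 + s\<^sup>2) * (norm (snd p))\<^sup>2"
    unfolding power2_norm_eq_inner
    by (simp add: inner_add_left inner_add_right inner_diff_left inner_diff_right
        inner_commute power2_eq_square algebra_simps)
  finally have "(norm (rot c s p))\<^sup>2 = (norm p)\<^sup>2"
    using assms by (cases p) (simp add: norm_Pair)
  then show ?thesis by simp
qed

text \<open>The density depends only on the norm, and a rotation preserves both the norm and
  Lebesgue measure.\<close>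

lemma distr_gauss_rot:
  assumes cs: "c\<^sup>2 + s\<^sup>2 = 1" "c \<noteq> -1"
  shows "distr gauss borel (rot c s) = (gauss :: ('a::euclidean_space \<times> 'a) measure)"
proof (rule measure_eqI)
  fix A :: "('a \<times> 'a) set"
  assume "A \<in> sets (distr gauss borel (rot c s))"
  then have A[measurable]: "A \<in> sets borel" by simp
  have "emeasure (distr gauss borel (rot c s)) A = (\<integral>\<^sup>+p. indicator A p \<partial>distr gauss borel (rot c s))"
    by simp
  also have "\<dots> = (\<integral>\<^sup>+p. indicator A (rot c s p) \<partial>gauss)"
    by (rule nn_integral_distr) (auto intro: borel_measurable_rot)
  also have "\<dots> = (\<integral>\<^sup>+p. ennreal (gauss_density (rot c s p)) * indicator A (rot c s p) \<partial>lborel)"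
    unfolding gauss_def by (subst nn_integral_density) (auto simp: gauss_density_eq norm_rot[OF cs(1)])
  also have "\<dots> = (\<integral>\<^sup>+p. ennreal (gauss_density p) * indicator A p \<partial>lborel)"
    by (rule nn_integral_lborel_rot[OF _ cs, where h = "\<lambda>p. ennreal (gauss_density p) * indicator A p"]) simp
  also have "\<dots> = emeasure gauss A"
    unfolding gauss_def by (simp add: emeasure_density)
  finally show "emeasure (distr gauss borel (rot c s)) A = emeasure gauss A" .
qed simp

lemma integral_gauss_rot:
  fixes h :: "'a::euclidean_space \<times> 'a \<Rightarrow> real"
  assumes cs: "c\<^sup>2 + s\<^sup>2 = 1" "c \<noteq> -1" and h: "h \<in> borel_measurable borel"
  shows "(\<integral>p. h (rot c s p) \<partial>gauss) = (\<integral>p. h p \<partial>gauss)"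
proof -
  have "(\<integral>p. h p \<partial>gauss) = (\<integral>p. h p \<partial>distr gauss borel (rot c s))"
    by (simp add: distr_gauss_rot[OF cs])
  also have "\<dots> = (\<integral>p. h (rot c s p) \<partial>gauss)"
    by (rule integral_distr) (auto simp: h)
  finally show ?thesis ..
qed

lemma integral_gauss_pair:
  fixes h :: "'a::euclidean_space \<times> 'b::euclidean_space \<Rightarrow> real"
  assumes "integrable gauss h"
  shows "(\<integral>p. h p \<partial>gauss) = (\<integral>x. (\<integral>y. h (x, y) \<partial>gauss) \<partial>gauss)"
proof -
  interpret pair_sigma_finite "gauss :: 'a measure" "gauss :: 'b measure" ..
  show ?thesis using integral_fst'[of h] assms by (simp add: gauss_pair)
qed

section \<open>Integration by parts\<close>

text \<open>The Cameron-Martin formula: the exponential is the ratio of the shifted to the original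
  density.\<close>

lemma integral_gauss_shift:
  fixes k :: "'a::euclidean_space \<Rightarrow> real"
  assumes [measurable]: "k \<in> borel_measurable borel"
  shows "(\<integral>y. k (y + c) \<partial>gauss) = (\<integral>y. k y * exp (y \<bullet> c - (norm c)\<^sup>2 / 2) \<partial>gauss)"
proof -
  have dens: "gauss_density (y - c) = gauss_density y * exp (y \<bullet> c - (norm c)\<^sup>2 / 2)" for y :: 'a
    by (simp add: gauss_density_eq exp_add[symmetric] power2_norm_eq_inner inner_diff_left
        inner_diff_right inner_commute field_simps)
  have "(\<integral>y. k (y + c) \<partial>gauss) = (\<integral>y. gauss_density y * k (y + c) \<partial>lborel)"
    unfolding gauss_def by (subst integral_density) auto
  also have "\<dots> = (\<integral>y. gauss_density y * k (y + c) \<partial>distr lborel borel ((+) (- c)))"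
    by (simp add: lborel_distr_plus)
  also have "\<dots> = (\<integral>y. gauss_density (y - c) * k y \<partial>lborel)"
    by (subst integral_distr) auto
  also have "\<dots> = (\<integral>y. k y * exp (y \<bullet> c - (norm c)\<^sup>2 / 2) \<partial>gauss)"
    unfolding gauss_def by (subst integral_density) (auto simp: dens ac_simps)
  finally show ?thesis .
qed

text \<open>Differentiating the shift formula at 0 gives Gaussian integration by parts.\<close>

lemma gauss_integration_by_parts:
  fixes k :: "'a::euclidean_space \<Rightarrow> real"
  assumes der: "\<And>y. (k has_derivative k' y) (at y)"
    and k: "exp_bdd k" and k': "exp_bdd (\<lambda>y. k' y e)"
  shows "(\<integral>y. (y \<bullet> e) * k y \<partial>gauss) = (\<integral>y. k' y e \<partial>gauss)"
proof -
  have "continuous_on UNIV k"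
    using der by (meson continuous_at_imp_continuous_on has_derivative_continuous)
  then have [measurable]: "k \<in> borel_measurable borel"
    by (rule borel_measurable_continuous_onI)
  obtain C c where C: "0 \<le> C" "0 \<le> c" "\<And>x. norm (k x) \<le> C * exp (c * norm x)"
    using exp_bddE[OF k] by blast
  obtain D d where D: "0 \<le> D" "0 \<le> d" "\<And>x. norm (k' x e) \<le> D * exp (d * norm x)"
    using exp_bddE[OF k'] by blast
  \<comment> \<open>Both sides of the shift formula with shift \<open>s *\<^sub>R e\<close> are
    differentiated at 0. On this side the derivative falls on \<open>k\<close>.\<close>
  have L: "((\<lambda>s. \<integral>y. k (y + s *\<^sub>R e) \<partial>gauss) has_real_derivative (\<integral>y. k' (y + 0 *\<^sub>R e) e \<partial>gauss)) (at 0)"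
  proof (rule has_real_derivative_integral[where r = 1 and w = "\<lambda>y. (D * exp (d * norm e)) * exp (d * norm y)"
        and h' = "\<lambda>s y. k' (y + s *\<^sub>R e) e"])
    fix s :: real
    show "integrable gauss (\<lambda>y. k (y + s *\<^sub>R e))"
    proof (rule integrable_gauss)
      have "norm (k (y + s *\<^sub>R e)) \<le> (C * exp (c * norm (s *\<^sub>R e))) * exp (c * norm y)" for y
      proof -
        have "norm (k (y + s *\<^sub>R e)) \<le> C * exp (c * norm (y + s *\<^sub>R e))" by (rule C)
        also have "\<dots> \<le> C * exp (c * (norm y + norm (s *\<^sub>R e)))"
          using C norm_triangle_ineq[of y "s *\<^sub>R e"]
          by (intro mult_left_mono) (auto intro!: mult_left_mono simp del: norm_scaleR)
        finally show ?thesis by (simp add: exp_add distrib_left ac_simps)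
      qed
      then show "exp_bdd (\<lambda>y. k (y + s *\<^sub>R e))" by (rule exp_bddI)
    qed measurable
    fix y
    have "((\<lambda>s. k (y + s *\<^sub>R e)) has_derivative (\<lambda>h. k' (y + s *\<^sub>R e) (h *\<^sub>R e))) (at s)"
      by (rule has_derivative_compose[OF _ der]) (auto intro!: derivative_eq_intros)
    then show "((\<lambda>s. k (y + s *\<^sub>R e)) has_real_derivative k' (y + s *\<^sub>R e) e) (at s)"
      by (rule has_derivative_imp_has_field_derivative)
         (simp add: linear_cmul[OF has_derivative_linear[OF der]])
    assume s: "\<bar>s - 0\<bar> < 1"
    have "norm (k' (y + s *\<^sub>R e) e) \<le> D * exp (d * norm (y + s *\<^sub>R e))" by (rule D)
    also have "\<dots> \<le> D * exp (d * (norm y + norm e))"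
    proof -
      have "norm (y + s *\<^sub>R e) \<le> norm y + \<bar>s\<bar> * norm e"
        using norm_triangle_ineq[of y "s *\<^sub>R e"] by simp
      also have "\<bar>s\<bar> * norm e \<le> 1 * norm e" using s by (intro mult_right_mono) auto
      finally show ?thesis using D by (intro mult_left_mono) (auto intro!: mult_left_mono)
    qed
    finally show "\<bar>k' (y + s *\<^sub>R e) e\<bar> \<le> (D * exp (d * norm e)) * exp (d * norm y)"
      by (simp add: exp_add distrib_left ac_simps)
  qed (auto intro!: integrable_mult_right integrable_gauss_exp_norm)
  \<comment> \<open>On the other side it falls on the exponential weight, which contributes the
    factor \<open>y \<bullet> e\<close> at \<open>s = 0\<close>.\<close>
  have R: "((\<lambda>s. \<integral>y. k y * exp (s * (y \<bullet> e) - s\<^sup>2 * (norm e)\<^sup>2 / 2) \<partial>gauss) has_real_derivative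
     (\<integral>y. k y * (exp (0 * (y \<bullet> e) - 0\<^sup>2 * (norm e)\<^sup>2 / 2) * ((y \<bullet> e) - 0 * (norm e)\<^sup>2)) \<partial>gauss)) (at 0)"
  proof (rule has_real_derivative_integral[where r = 1
        and w = "\<lambda>y. \<bar>k y\<bar> * (exp (norm e * norm y) * (norm y * norm e + (norm e)\<^sup>2))"
        and h' = "\<lambda>s y. k y * (exp (s * (y \<bullet> e) - s\<^sup>2 * (norm e)\<^sup>2 / 2) * ((y \<bullet> e) - s * (norm e)\<^sup>2))"])
    have exp_le: "exp (s * (y \<bullet> e) - s\<^sup>2 * (norm e)\<^sup>2 / 2) \<le> exp (\<bar>s\<bar> * (norm e * norm y))" for s and y :: 'a
    proof -
      have "s * (y \<bullet> e) \<le> \<bar>s\<bar> * \<bar>y \<bullet> e\<bar>" by (metis abs_ge_self abs_mult)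
      also have "\<dots> \<le> \<bar>s\<bar> * (norm e * norm y)"
        using Cauchy_Schwarz_ineq2[of y e] by (intro mult_left_mono) (auto simp: mult.commute)
      finally have "s * (y \<bullet> e) \<le> \<bar>s\<bar> * (norm e * norm y)" .
      moreover have "0 \<le> s\<^sup>2 * (norm e)\<^sup>2 / 2" by simp
      ultimately have "s * (y \<bullet> e) - s\<^sup>2 * (norm e)\<^sup>2 / 2 \<le> \<bar>s\<bar> * (norm e * norm y)" by linarith
      then show ?thesis by simp
    qed
    fix s :: real
    have "exp_bdd (\<lambda>y::'a. exp (s * (y \<bullet> e) - s\<^sup>2 * (norm e)\<^sup>2 / 2))"
      using exp_le[of s] by (intro exp_bddI[where C = 1 and c = "\<bar>s\<bar> * norm e"]) (simp add: ac_simps)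
    then show "integrable gauss (\<lambda>y. k y * exp (s * (y \<bullet> e) - s\<^sup>2 * (norm e)\<^sup>2 / 2))"
      by (intro integrable_gauss exp_bdd_mult k) measurable
    fix y :: 'a
    show "((\<lambda>s. k y * exp (s * (y \<bullet> e) - s\<^sup>2 * (norm e)\<^sup>2 / 2)) has_real_derivative
       k y * (exp (s * (y \<bullet> e) - s\<^sup>2 * (norm e)\<^sup>2 / 2) * ((y \<bullet> e) - s * (norm e)\<^sup>2))) (at s)"
      by (auto intro!: derivative_eq_intros)
    assume s: "\<bar>s - 0\<bar> < 1"
    have 1: "exp (s * (y \<bullet> e) - s\<^sup>2 * (norm e)\<^sup>2 / 2) \<le> exp (norm e * norm y)"
      using exp_le[of s y] s mult_left_le_one_le[of "norm e * norm y" "\<bar>s\<bar>"]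
      by (smt (verit) exp_le_cancel_iff mult_nonneg_nonneg norm_ge_zero)
    have 2: "\<bar>(y \<bullet> e) - s * (norm e)\<^sup>2\<bar> \<le> norm y * norm e + (norm e)\<^sup>2"
    proof -
      have "\<bar>s * (norm e)\<^sup>2\<bar> \<le> 1 * (norm e)\<^sup>2"
        unfolding abs_mult using s by (intro mult_mono) auto
      then show ?thesis using Cauchy_Schwarz_ineq2[of y e] by linarith
    qed
    show "\<bar>k y * (exp (s * (y \<bullet> e) - s\<^sup>2 * (norm e)\<^sup>2 / 2) * ((y \<bullet> e) - s * (norm e)\<^sup>2))\<bar>
        \<le> \<bar>k y\<bar> * (exp (norm e * norm y) * (norm y * norm e + (norm e)\<^sup>2))"
      unfolding abs_mult using 1 2 by (intro mult_left_mono mult_mono) auto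
  next
    have "exp_bdd (\<lambda>y. \<bar>k y\<bar>)" using k by (rule exp_bdd_mono) simp
    moreover have "exp_bdd (\<lambda>y::'a. exp (norm e * norm y))"
      using exp_bdd_exp_norm[of 1 "norm e"] by simp
    moreover have "exp_bdd (\<lambda>y::'a. norm y * norm e + (norm e)\<^sup>2)"
      by (intro exp_bdd_add exp_bdd_mult exp_bdd_const
          exp_bdd_mono[OF exp_bdd_linear[OF bounded_linear_ident]]) simp
    ultimately show "integrable gauss (\<lambda>y. \<bar>k y\<bar> * (exp (norm e * norm y) * (norm y * norm e + (norm e)\<^sup>2)))"
      by (intro integrable_gauss exp_bdd_mult) measurable
  qed simp
  have "(\<lambda>s. \<integral>y. k (y + s *\<^sub>R e) \<partial>gauss) = (\<lambda>s. \<integral>y. k y * exp (s * (y \<bullet> e) - s\<^sup>2 * (norm e)\<^sup>2 / 2) \<partial>gauss)"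
    by (simp add: fun_eq_iff integral_gauss_shift power_mult_distrib)
  from DERIV_unique[OF L[unfolded this] R] show ?thesis by (simp add: mult.commute)
qed

section \<open>Interpolation by rotating a Gaussian pair\<close>

text \<open>Continuity and growth of the derivative are asked only along basis vectors; general
  directions follow by linearity (\<open>exp_C1_expand\<close>).\<close>

definition exp_C1 :: "('a::euclidean_space \<Rightarrow> real) \<Rightarrow> ('a \<Rightarrow> 'a \<Rightarrow> real) \<Rightarrow> bool" where
  "exp_C1 u u' \<longleftrightarrow> (\<forall>x. (u has_derivative u' x) (at x)) \<and> exp_bdd u
    \<and> (\<forall>i\<in>Basis. continuous_on UNIV (\<lambda>x. u' x i) \<and> exp_bdd (\<lambda>x. u' x i))"

lemma exp_C1D:
  assumes "exp_C1 u u'"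
  shows "\<And>x. (u has_derivative u' x) (at x)" "exp_bdd u" "continuous_on UNIV u"
    "\<And>i. i \<in> Basis \<Longrightarrow> continuous_on UNIV (\<lambda>x. u' x i)" "\<And>i. i \<in> Basis \<Longrightarrow> exp_bdd (\<lambda>x. u' x i)"
  using assms unfolding exp_C1_def
  by (auto intro!: continuous_at_imp_continuous_on dest: has_derivative_continuous)

lemma exp_C1_expand:
  assumes "exp_C1 u u'"
  shows "u' x y = (\<Sum>i\<in>Basis. (y \<bullet> i) * u' x i)"
proof -
  interpret linear "u' x" using exp_C1D(1)[OF assms] by (rule has_derivative_linear)
  have "u' x y = u' x (\<Sum>i\<in>Basis. (y \<bullet> i) *\<^sub>R i)" by (simp add: euclidean_representation)
  then show ?thesis by (simp add: sum scale)
qed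

lemma exp_bdd_abs: "exp_bdd h \<Longrightarrow> exp_bdd (\<lambda>x. \<bar>h x :: real\<bar>)"
  by (erule exp_bdd_mono) simp

text \<open>The bound is uniform in the direction \<open>y\<close> because the rotation
  differentiates \<open>u\<close> in a direction that is itself random.\<close>

lemma exp_C1_bound:
  assumes "exp_C1 u u'"
  obtains C c where "0 \<le> C" "0 \<le> c" "\<And>x y. \<bar>u' x y\<bar> \<le> C * exp (c * norm x) * norm y"
proof -
  have "exp_bdd (\<lambda>x. \<Sum>i\<in>Basis. \<bar>u' x i\<bar>)"
    by (intro exp_bdd_sum exp_bdd_abs exp_C1D(5)[OF assms])
  then obtain C c where C: "0 \<le> C" "0 \<le> c"
    "\<And>x. norm (\<Sum>i\<in>Basis. \<bar>u' x i\<bar>) \<le> C * exp (c * norm x)"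
    using exp_bddE by blast
  have "\<bar>u' x y\<bar> \<le> C * exp (c * norm x) * norm y" for x y
  proof -
    have "\<bar>u' x y\<bar> \<le> (\<Sum>i\<in>Basis. \<bar>(y \<bullet> i) * u' x i\<bar>)"
      unfolding exp_C1_expand[OF assms, of x y] by (rule sum_abs)
    also have "\<dots> \<le> (\<Sum>i\<in>Basis. norm y * \<bar>u' x i\<bar>)"
      unfolding abs_mult by (intro sum_mono mult_right_mono Basis_le_norm) auto
    also have "\<dots> = (\<Sum>i\<in>Basis. \<bar>u' x i\<bar>) * norm y"
      by (simp add: sum_distrib_left mult.commute)
    also have "\<dots> \<le> C * exp (c * norm x) * norm y"
      using C(3)[of x] by (intro mult_right_mono) auto
    finally show ?thesis .
  qed
  with C show thesis using that by blast
qed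

lemma exp_bdd_fst: "exp_bdd h \<Longrightarrow> exp_bdd (\<lambda>p. h (fst p))"
  by (rule exp_bdd_compose[OF _ bounded_linear_fst])

lemma exp_bdd_combine: "exp_bdd h \<Longrightarrow> exp_bdd (\<lambda>p. h (a *\<^sub>R fst p + b *\<^sub>R snd p))"
  by (erule exp_bdd_compose[where T = "\<lambda>p. a *\<^sub>R fst p + b *\<^sub>R snd p"])
     (intro bounded_linear_add bounded_linear_scaleR_right[THEN bounded_linear_compose]
        bounded_linear_fst bounded_linear_snd)

lemma norm_combine_cos_sin:
  "norm (cos \<phi> *\<^sub>R x + sin \<phi> *\<^sub>R y) \<le> norm x + norm y" "norm (cos \<phi> *\<^sub>R y - sin \<phi> *\<^sub>R x) \<le> norm x + norm y"
proof -
  have "norm (cos \<phi> *\<^sub>R z) \<le> norm z" "norm (sin \<phi> *\<^sub>R z) \<le> norm z" for z :: 'a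
    by (auto intro!: mult_left_le_one_le)
  then show "norm (cos \<phi> *\<^sub>R x + sin \<phi> *\<^sub>R y) \<le> norm x + norm y" "norm (cos \<phi> *\<^sub>R y - sin \<phi> *\<^sub>R x) \<le> norm x + norm y"
    by (smt (verit) norm_triangle_ineq norm_triangle_ineq4)+
qed

lemma exp_norm_fst_snd_le:
  assumes "0 \<le> c" "norm z \<le> norm (fst p) + norm (snd p)"
  shows "exp (c * norm z) \<le> exp (2 * c * norm p)"
proof -
  have "norm (fst p) \<le> norm p" "norm (snd p) \<le> norm p"
    by (cases p, simp add: norm_Pair real_le_rsqrt)+
  then have "norm z \<le> 2 * norm p" using assms(2) by linarith
  from mult_left_mono[OF this assms(1)] show ?thesis by simp
qed

lemma gauss_rotation_derivative:
  fixes u g :: "'a::euclidean_space \<Rightarrow> real"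
  assumes u: "exp_C1 u u'" and g: "exp_C1 g g'"
  shows "((\<lambda>\<phi>. \<integral>p. u (cos \<phi> *\<^sub>R fst p + sin \<phi> *\<^sub>R snd p) * g (fst p) \<partial>gauss) has_real_derivative
     (\<integral>p. u' (cos \<phi> *\<^sub>R fst p + sin \<phi> *\<^sub>R snd p) (cos \<phi> *\<^sub>R snd p - sin \<phi> *\<^sub>R fst p) * g (fst p) \<partial>gauss)) (at \<phi>)"
proof -
  obtain C c where C: "0 \<le> C" "0 \<le> c" "\<And>x y. \<bar>u' x y\<bar> \<le> C * exp (c * norm x) * norm y"
    using exp_C1_bound[OF u] by blast
  note cont = continuous_on_compose2[OF exp_C1D(3)[OF u]] continuous_on_compose2[OF exp_C1D(3)[OF g]]
  show ?thesis
  \<comment> \<open>Both components of the rotated pair have norm at most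
    \<open>norm (fst p) + norm (snd p)\<close>, hence at most \<open>2 * norm p\<close>, whatever
    the angle; so \<open>w\<close> does not depend on it. The second exponential in \<open>w\<close>
    absorbs the linear factor \<open>norm Y\<close>.\<close>
  proof (rule has_real_derivative_integral[where r = 1
        and w = "\<lambda>p. C * exp (2 * c * norm p) * exp (2 * 1 * norm p) * \<bar>g (fst p)\<bar>"
        and h' = "\<lambda>\<phi> p. u' (cos \<phi> *\<^sub>R fst p + sin \<phi> *\<^sub>R snd p) (cos \<phi> *\<^sub>R snd p - sin \<phi> *\<^sub>R fst p) * g (fst p)"])
    fix \<phi> :: real
    show "integrable gauss (\<lambda>p. u (cos \<phi> *\<^sub>R fst p + sin \<phi> *\<^sub>R snd p) * g (fst p))"
      by (intro integrable_gauss exp_bdd_mult exp_bdd_combine exp_bdd_fst exp_C1D(2)[OF u] exp_C1D(2)[OF g]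
          borel_measurable_continuous_onI continuous_intros cont) auto
    fix p :: "'a \<times> 'a"
    define X where "X = cos \<phi> *\<^sub>R fst p + sin \<phi> *\<^sub>R snd p"
    define Y where "Y = cos \<phi> *\<^sub>R snd p - sin \<phi> *\<^sub>R fst p"
    have "((\<lambda>\<phi>. u (cos \<phi> *\<^sub>R fst p + sin \<phi> *\<^sub>R snd p)) has_derivative (\<lambda>h. u' X (h *\<^sub>R Y))) (at \<phi>)"
      unfolding X_def by (rule has_derivative_compose[OF _ exp_C1D(1)[OF u]])
        (auto intro!: derivative_eq_intros simp: Y_def algebra_simps)
    then have "((\<lambda>\<phi>. u (cos \<phi> *\<^sub>R fst p + sin \<phi> *\<^sub>R snd p)) has_real_derivative u' X Y) (at \<phi>)"
      by (rule has_derivative_imp_has_field_derivative)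
         (simp add: linear_cmul[OF has_derivative_linear[OF exp_C1D(1)[OF u]]])
    then show "((\<lambda>\<phi>. u (cos \<phi> *\<^sub>R fst p + sin \<phi> *\<^sub>R snd p) * g (fst p)) has_real_derivative
        u' (cos \<phi> *\<^sub>R fst p + sin \<phi> *\<^sub>R snd p) (cos \<phi> *\<^sub>R snd p - sin \<phi> *\<^sub>R fst p) * g (fst p)) (at \<phi>)"
      unfolding X_def Y_def by (rule DERIV_cmult_right)
    have "\<bar>u' X Y\<bar> \<le> C * exp (c * norm X) * norm Y" by (rule C)
    also have "\<dots> \<le> C * exp (c * norm X) * exp (1 * norm Y)"
    proof -
      have "norm Y \<le> exp (1 * norm Y)" unfolding mult_1 using exp_ge_add_one_self[of "norm Y"] by linarith
      then show ?thesis using C(1) by (intro mult_left_mono) auto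
    qed
    also have "\<dots> \<le> C * exp (2 * c * norm p) * exp (2 * 1 * norm p)"
      unfolding X_def Y_def
      by (intro mult_mono mult_left_mono exp_norm_fst_snd_le norm_combine_cos_sin) (simp_all add: C)
    finally show "\<bar>u' (cos \<phi> *\<^sub>R fst p + sin \<phi> *\<^sub>R snd p) (cos \<phi> *\<^sub>R snd p - sin \<phi> *\<^sub>R fst p) * g (fst p)\<bar>
        \<le> C * exp (2 * c * norm p) * exp (2 * 1 * norm p) * \<bar>g (fst p)\<bar>"
      unfolding abs_mult X_def Y_def by (rule mult_right_mono) simp
  next
    have 1: "exp_bdd (\<lambda>p :: 'a \<times> 'a. C * exp (2 * c * norm p))" by (rule exp_bdd_exp_norm)
    have 2: "exp_bdd (\<lambda>p :: 'a \<times> 'a. exp (2 * 1 * norm p))"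
      using exp_bdd_exp_norm[of 1 "2 * 1"] by simp
    have 3: "exp_bdd (\<lambda>p :: 'a \<times> 'a. \<bar>g (fst p)\<bar>)"
      by (intro exp_bdd_abs exp_bdd_fst exp_C1D(2)[OF g])
    show "integrable gauss (\<lambda>p :: 'a \<times> 'a. C * exp (2 * c * norm p) * exp (2 * 1 * norm p) * \<bar>g (fst p)\<bar>)"
      by (intro integrable_gauss exp_bdd_mult 1 2 3 borel_measurable_continuous_onI continuous_intros cont) auto
  qed simp
qed

text \<open>In rotated coordinates (x, y) the old first component is
  \<open>c *\<^sub>R x - s *\<^sub>R y\<close>, and y is Gaussian and independent of x. Integrating
  by parts in y with x fixed trades each coordinate of y for a derivative of \<open>g\<close>, and
  the chain rule produces the factor \<open>- s\<close>.\<close>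

lemma gauss_rotation_by_parts:
  fixes u g :: "'a::euclidean_space \<Rightarrow> real"
  assumes u: "exp_C1 u u'" and g: "exp_C1 g g'" and cs: "c\<^sup>2 + s\<^sup>2 = 1" "c \<noteq> -1"
  shows "(\<integral>p. u' (c *\<^sub>R fst p + s *\<^sub>R snd p) (c *\<^sub>R snd p - s *\<^sub>R fst p) * g (fst p) \<partial>gauss)
     = - s * (\<Sum>i\<in>Basis. \<integral>p. u' (fst p) i * g' (c *\<^sub>R fst p - s *\<^sub>R snd p) i \<partial>gauss)"
proof -
  \<comment> \<open>The integrand in rotated coordinates, with the derivative of \<open>u\<close>
    expanded over the basis so that the coordinates of y appear as factors.\<close>
  define H where "H p = (\<Sum>i\<in>Basis. (snd p \<bullet> i) * (u' (fst p) i * g (c *\<^sub>R fst p + (- s) *\<^sub>R snd p)))" for p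
  note cont = continuous_on_compose2[OF exp_C1D(4)[OF u]] continuous_on_compose2[OF exp_C1D(3)[OF g]]
    continuous_on_compose2[OF exp_C1D(4)[OF g]]
  have bdd_snd: "exp_bdd (\<lambda>p :: 'a \<times> 'a. snd p \<bullet> i)" for i
    by (intro exp_bdd_linear bounded_linear_inner_left[THEN bounded_linear_compose] bounded_linear_snd)
  have inv: "c *\<^sub>R (c *\<^sub>R x + s *\<^sub>R y) + (- s) *\<^sub>R (c *\<^sub>R y - s *\<^sub>R x) = x" for x y :: 'a
  proof -
    have "c *\<^sub>R (c *\<^sub>R x + s *\<^sub>R y) + (- s) *\<^sub>R (c *\<^sub>R y - s *\<^sub>R x) = (c\<^sup>2 + s\<^sup>2) *\<^sub>R x"
      by (simp add: algebra_simps power2_eq_square)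
    then show ?thesis using cs(1) by simp
  qed
  have "u' (c *\<^sub>R fst p + s *\<^sub>R snd p) (c *\<^sub>R snd p - s *\<^sub>R fst p) * g (fst p) = H (rot c s p)" for p
    unfolding exp_C1_expand[OF u, of _ "c *\<^sub>R snd p - s *\<^sub>R fst p"] H_def rot_def fst_conv snd_conv inv
    by (simp add: sum_distrib_right mult.assoc)
  then have "(\<integral>p. u' (c *\<^sub>R fst p + s *\<^sub>R snd p) (c *\<^sub>R snd p - s *\<^sub>R fst p) * g (fst p) \<partial>gauss)
      = (\<integral>p. H (rot c s p) \<partial>gauss)" by simp
  also have "\<dots> = (\<integral>p. H p \<partial>gauss)"
    unfolding H_def by (intro integral_gauss_rot cs borel_measurable_continuous_onI continuous_intros cont) auto
  also have "\<dots> = (\<Sum>i\<in>Basis. \<integral>p. (snd p \<bullet> i) * (u' (fst p) i * g (c *\<^sub>R fst p + (- s) *\<^sub>R snd p)) \<partial>gauss)"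
    unfolding H_def
    by (intro Bochner_Integration.integral_sum integrable_gauss exp_bdd_mult bdd_snd exp_bdd_fst
          exp_bdd_combine exp_C1D(5)[OF u] exp_C1D(2)[OF g]
          borel_measurable_continuous_onI continuous_intros cont) auto
  also have "\<dots> = (\<Sum>i\<in>Basis. - s * (\<integral>p. u' (fst p) i * g' (c *\<^sub>R fst p + (- s) *\<^sub>R snd p) i \<partial>gauss))"
  proof (rule sum.cong[OF refl])
    fix i :: 'a assume i: "i \<in> Basis"
    have ibp: "(\<integral>y. (y \<bullet> i) * g (c *\<^sub>R x + (- s) *\<^sub>R y) \<partial>gauss)
        = - s * (\<integral>y. g' (c *\<^sub>R x + (- s) *\<^sub>R y) i \<partial>gauss)" for x
    proof -
      have aff: "exp_bdd (\<lambda>y. h (c *\<^sub>R x + (- s) *\<^sub>R y))" if h: "exp_bdd h" for h :: "'a \<Rightarrow> real"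
      proof -
        obtain D d where D: "0 \<le> D" "0 \<le> d" "\<And>x. norm (h x) \<le> D * exp (d * norm x)"
          using exp_bddE[OF h] by blast
        have "norm (h (c *\<^sub>R x + (- s) *\<^sub>R y)) \<le> (D * exp (d * norm (c *\<^sub>R x))) * exp ((d * \<bar>s\<bar>) * norm y)" for y
        proof -
          have "norm (h (c *\<^sub>R x + (- s) *\<^sub>R y)) \<le> D * exp (d * norm (c *\<^sub>R x + (- s) *\<^sub>R y))" by (rule D)
          also have "\<dots> \<le> D * exp (d * (norm (c *\<^sub>R x) + norm ((- s) *\<^sub>R y)))"
            using D norm_triangle_ineq[of "c *\<^sub>R x" "(- s) *\<^sub>R y"]
            by (intro mult_left_mono) (auto intro!: mult_left_mono simp del: norm_scaleR)
          finally show ?thesis by (simp add: exp_add distrib_left ac_simps)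
        qed
        then show ?thesis by (rule exp_bddI)
      qed
      have "(\<integral>y. (y \<bullet> i) * g (c *\<^sub>R x + (- s) *\<^sub>R y) \<partial>gauss)
          = (\<integral>y. g' (c *\<^sub>R x + (- s) *\<^sub>R y) ((- s) *\<^sub>R i) \<partial>gauss)"
      proof (rule gauss_integration_by_parts[where k' = "\<lambda>y h. g' (c *\<^sub>R x + (- s) *\<^sub>R y) ((- s) *\<^sub>R h)"])
        fix y
        show "((\<lambda>y. g (c *\<^sub>R x + (- s) *\<^sub>R y)) has_derivative
            (\<lambda>h. g' (c *\<^sub>R x + (- s) *\<^sub>R y) ((- s) *\<^sub>R h))) (at y)"
          by (rule has_derivative_compose[OF _ exp_C1D(1)[OF g]]) (auto intro!: derivative_eq_intros)
      next
        show "exp_bdd (\<lambda>y. g (c *\<^sub>R x + (- s) *\<^sub>R y))"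
          by (rule aff) (rule exp_C1D(2)[OF g])
        have "exp_bdd (\<lambda>y. (- s) * g' (c *\<^sub>R x + (- s) *\<^sub>R y) i)"
          by (intro exp_bdd_mult exp_bdd_const aff exp_C1D(5)[OF g] i)
        then show "exp_bdd (\<lambda>y. g' (c *\<^sub>R x + (- s) *\<^sub>R y) ((- s) *\<^sub>R i))"
          by (simp only: linear_cmul[OF has_derivative_linear[OF exp_C1D(1)[OF g]]] real_scaleR_def)
      qed
      also have "\<dots> = (\<integral>y. (- s) * g' (c *\<^sub>R x + (- s) *\<^sub>R y) i \<partial>gauss)"
        by (simp only: linear_cmul[OF has_derivative_linear[OF exp_C1D(1)[OF g]]] real_scaleR_def)
      finally show ?thesis by simp
    qed
    have "(\<integral>p. (snd p \<bullet> i) * (u' (fst p) i * g (c *\<^sub>R fst p + (- s) *\<^sub>R snd p)) \<partial>gauss)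
        = (\<integral>x. \<integral>y. (y \<bullet> i) * (u' x i * g (c *\<^sub>R x + (- s) *\<^sub>R y)) \<partial>gauss \<partial>gauss)"
      using i by (subst integral_gauss_pair, intro integrable_gauss exp_bdd_mult bdd_snd exp_bdd_fst
          exp_bdd_combine exp_C1D(5)[OF u] exp_C1D(2)[OF g]
          borel_measurable_continuous_onI continuous_intros cont) auto
    also have "\<dots> = (\<integral>x. u' x i * (\<integral>y. (y \<bullet> i) * g (c *\<^sub>R x + (- s) *\<^sub>R y) \<partial>gauss) \<partial>gauss)"
      by (simp add: mult.left_commute[of _ "u' _ i"])
    also have "\<dots> = (\<integral>x. - s * (\<integral>y. u' x i * g' (c *\<^sub>R x + (- s) *\<^sub>R y) i \<partial>gauss) \<partial>gauss)"
      unfolding ibp by (simp add: mult.left_commute)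
    also have "\<dots> = - s * (\<integral>x. \<integral>y. u' x i * g' (c *\<^sub>R x + (- s) *\<^sub>R y) i \<partial>gauss \<partial>gauss)"
      by (rule integral_mult_right_zero)
    also have "(\<integral>x. \<integral>y. u' x i * g' (c *\<^sub>R x + (- s) *\<^sub>R y) i \<partial>gauss \<partial>gauss)
        = (\<integral>p. u' (fst p) i * g' (c *\<^sub>R fst p + (- s) *\<^sub>R snd p) i \<partial>gauss)"
      using i by (subst integral_gauss_pair, intro integrable_gauss exp_bdd_mult exp_bdd_fst
          exp_bdd_combine exp_C1D(5)[OF u] exp_C1D(5)[OF g]
          borel_measurable_continuous_onI continuous_intros cont) auto
    finally show "(\<integral>p. (snd p \<bullet> i) * (u' (fst p) i * g (c *\<^sub>R fst p + (- s) *\<^sub>R snd p)) \<partial>gauss)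
        = - s * (\<integral>p. u' (fst p) i * g' (c *\<^sub>R fst p + (- s) *\<^sub>R snd p) i \<partial>gauss)" .
  qed
  finally show ?thesis by (simp add: sum_distrib_left)
qed

text \<open>The combination is the first component of the pair rotated by the opposite angle, hence
  again standard Gaussian.\<close>

lemma integral_gauss_combine:
  fixes W :: "'a::euclidean_space \<Rightarrow> real"
  assumes cs: "c\<^sup>2 + s\<^sup>2 = 1" "c \<noteq> -1" and W: "continuous_on UNIV W" "exp_bdd W"
  shows "(\<integral>p. W (c *\<^sub>R fst p - s *\<^sub>R snd p) \<partial>gauss) = (\<integral>x. W x \<partial>gauss)"
proof -
  note cont = continuous_on_compose2[OF W(1)]
  have "(\<integral>p. W (c *\<^sub>R fst p - s *\<^sub>R snd p) \<partial>gauss) = (\<integral>p. W (fst (rot c (- s) p)) \<partial>gauss)"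
    by (simp add: rot_def)
  also have "\<dots> = (\<integral>p. W (fst p) \<partial>(gauss :: ('a \<times> 'a) measure))"
    using cs by (intro integral_gauss_rot[where h = "\<lambda>p. W (fst p)"]
        borel_measurable_continuous_onI cont continuous_intros) auto
  also have "\<dots> = (\<integral>x. \<integral>y. W x \<partial>(gauss :: 'a measure) \<partial>gauss)"
    by (subst integral_gauss_pair, intro integrable_gauss exp_bdd_fst W
        borel_measurable_continuous_onI cont continuous_intros) auto
  also have "\<dots> = (\<integral>x. W x \<partial>gauss)"
    by (simp add: gauss.prob_space[unfolded space_gauss])
  finally show ?thesis .
qed

text \<open>Rotating a standard Gaussian pair by the angle \<open>\<phi>\<close> interpolates between
  \<open>\<Sum>\<^sub>k E (u\<^sub>k g\<^sub>k)\<close> at \<open>\<phi> = 0\<close> and \<open>\<Sum>\<^sub>k E u\<^sub>k * E g\<^sub>k\<close> at \<open>\<phi> = \<pi>/2\<close>.\<close>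

lemma gauss_covariance_le:
  fixes u g :: "'k \<Rightarrow> 'a::euclidean_space \<Rightarrow> real"
  assumes u: "\<And>k. k \<in> K \<Longrightarrow> exp_C1 (u k) (u' k)" and g: "\<And>k. k \<in> K \<Longrightarrow> exp_C1 (g k) (g' k)"
    and mean: "\<And>k. k \<in> K \<Longrightarrow> (\<integral>x. u k x \<partial>gauss) = 0"
    and W: "continuous_on UNIV W" "exp_bdd W"
    and bound: "\<And>x z. (\<Sum>k\<in>K. \<Sum>i\<in>Basis. u' k x i * g' k z i) \<le> W z"
  shows "(\<Sum>k\<in>K. \<integral>x. u k x * g k x \<partial>gauss) \<le> (\<integral>x. W x \<partial>gauss)"
proof -
  define \<Phi> where "\<Phi> k \<phi> = (\<integral>p. u k (cos \<phi> *\<^sub>R fst p + sin \<phi> *\<^sub>R snd p) * g k (fst p) \<partial>gauss)" for k \<phi>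
  define D where "D k \<phi> = (\<Sum>i\<in>Basis. \<integral>p. u' k (fst p) i * g' k (cos \<phi> *\<^sub>R fst p - sin \<phi> *\<^sub>R snd p) i \<partial>gauss)" for k \<phi>
  define w where "w = (\<integral>x. W x \<partial>gauss)"
  \<comment> \<open>Monotonicity replaces integration over the angle: - cos \<phi> has derivative
    sin \<phi> and increases by exactly 1 over the quarter turn, so the term
    \<open>cos \<phi> * w\<close> compensates the derivative of the covariance term.\<close>
  have le: "(\<Sum>k\<in>K. \<Phi> k 0) - cos 0 * w \<le> (\<Sum>k\<in>K. \<Phi> k (pi / 2)) - cos (pi / 2) * w"
  proof (rule DERIV_nonneg_imp_nondecreasing[where f = "\<lambda>\<phi>. (\<Sum>k\<in>K. \<Phi> k \<phi>) - cos \<phi> * w"])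
    fix \<phi> :: real assume \<phi>: "0 \<le> \<phi>" "\<phi> \<le> pi / 2"
    have sc: "0 \<le> sin \<phi>" "0 \<le> cos \<phi>"
      using \<phi> by (auto intro!: sin_ge_zero cos_ge_zero)
    have cs: "(cos \<phi>)\<^sup>2 + (sin \<phi>)\<^sup>2 = 1" "cos \<phi> \<noteq> -1"
      using sc by auto
    have der: "(\<Phi> k has_real_derivative - sin \<phi> * D k \<phi>) (at \<phi>)" if "k \<in> K" for k
      using gauss_rotation_derivative[OF u[OF that] g[OF that], of \<phi>]
      unfolding gauss_rotation_by_parts[OF u[OF that] g[OF that] cs] \<Phi>_def[abs_def] D_def .
    have "(\<Sum>k\<in>K. D k \<phi>) \<le> w"
    proof -
      have int: "integrable gauss (\<lambda>p. u' k (fst p) i * g' k (cos \<phi> *\<^sub>R fst p - sin \<phi> *\<^sub>R snd p) i)"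
        if "k \<in> K" "i \<in> Basis" for k i
      proof -
        note cont = continuous_on_compose2[OF exp_C1D(4)[OF u[OF that(1)] that(2)]]
          continuous_on_compose2[OF exp_C1D(4)[OF g[OF that(1)] that(2)]]
        have "integrable gauss (\<lambda>p. u' k (fst p) i * g' k (cos \<phi> *\<^sub>R fst p + (- sin \<phi>) *\<^sub>R snd p) i)"
          using that by (intro integrable_gauss exp_bdd_mult exp_bdd_fst exp_bdd_combine
            exp_C1D(5)[OF u] exp_C1D(5)[OF g] borel_measurable_continuous_onI continuous_intros cont) auto
        then show ?thesis by simp
      qed
      have "(\<Sum>k\<in>K. D k \<phi>)
          = (\<integral>p. (\<Sum>k\<in>K. \<Sum>i\<in>Basis. u' k (fst p) i * g' k (cos \<phi> *\<^sub>R fst p - sin \<phi> *\<^sub>R snd p) i) \<partial>gauss)"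
        using int unfolding D_def by (simp add: Bochner_Integration.integral_sum)
      also have "\<dots> \<le> (\<integral>p. W (cos \<phi> *\<^sub>R fst p - sin \<phi> *\<^sub>R snd p) \<partial>gauss)"
      proof (rule integral_mono)
        show "integrable gauss (\<lambda>p. \<Sum>k\<in>K. \<Sum>i\<in>Basis. u' k (fst p) i * g' k (cos \<phi> *\<^sub>R fst p - sin \<phi> *\<^sub>R snd p) i)"
          using int by (intro Bochner_Integration.integrable_sum) auto
        have "integrable gauss (\<lambda>p. W (cos \<phi> *\<^sub>R fst p + (- sin \<phi>) *\<^sub>R snd p))"
          by (intro integrable_gauss exp_bdd_combine W borel_measurable_continuous_onI
              continuous_intros continuous_on_compose2[OF W(1)]) auto
        then show "integrable gauss (\<lambda>p. W (cos \<phi> *\<^sub>R fst p - sin \<phi> *\<^sub>R snd p))" by simp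
      qed (rule bound)
      also have "\<dots> = w" unfolding w_def by (rule integral_gauss_combine[OF cs W])
      finally show ?thesis .
    qed
    then have "0 \<le> sin \<phi> * (w - (\<Sum>k\<in>K. D k \<phi>))"
      using sc by (intro mult_nonneg_nonneg) auto
    moreover have "((\<lambda>\<phi>. (\<Sum>k\<in>K. \<Phi> k \<phi>) - cos \<phi> * w) has_real_derivative
        sin \<phi> * (w - (\<Sum>k\<in>K. D k \<phi>))) (at \<phi>)"
      by (rule derivative_eq_intros der refl | assumption)+ (simp add: algebra_simps sum_distrib_left sum_negf)
    ultimately show "\<exists>y. ((\<lambda>\<phi>. (\<Sum>k\<in>K. \<Phi> k \<phi>) - cos \<phi> * w) has_real_derivative y) (at \<phi>) \<and> 0 \<le> y"
      by blast
  qed simp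
  have stop: "\<Phi> k (pi / 2) = 0" if k: "k \<in> K" for k
  proof -
    note cont = continuous_on_compose2[OF exp_C1D(3)[OF u[OF k]]] continuous_on_compose2[OF exp_C1D(3)[OF g[OF k]]]
    have "\<Phi> k (pi / 2) = (\<integral>p. u k (0 *\<^sub>R fst p + 1 *\<^sub>R snd p) * g k (fst p) \<partial>gauss)"
      by (simp add: \<Phi>_def)
    also have "\<dots> = (\<integral>x. \<integral>y. u k (0 *\<^sub>R x + 1 *\<^sub>R y) * g k x \<partial>gauss \<partial>gauss)"
      by (subst integral_gauss_pair, intro integrable_gauss exp_bdd_mult exp_bdd_fst exp_bdd_combine
            exp_C1D(2)[OF u] exp_C1D(2)[OF g] borel_measurable_continuous_onI continuous_intros cont k) auto
    also have "\<dots> = 0" using mean[OF k] by simp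
    finally show ?thesis .
  qed
  have start: "\<Phi> k 0 = (\<integral>x. u k x * g k x \<partial>gauss)" if k: "k \<in> K" for k
  proof -
    note cont = continuous_on_compose2[OF exp_C1D(3)[OF u[OF k]]] continuous_on_compose2[OF exp_C1D(3)[OF g[OF k]]]
    have "\<Phi> k 0 = (\<integral>x. \<integral>y. u k x * g k x \<partial>(gauss :: 'a measure) \<partial>gauss)"
      unfolding \<Phi>_def by (simp, subst integral_gauss_pair, intro integrable_gauss exp_bdd_mult exp_bdd_fst
            exp_C1D(2)[OF u] exp_C1D(2)[OF g] borel_measurable_continuous_onI continuous_intros cont k) auto
    then show ?thesis by (simp add: gauss.prob_space[unfolded space_gauss])
  qed
  show ?thesis using le start stop by (simp add: w_def)
qed

subsection \<open>The Banach algebra of endomorphisms\<close>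

text \<open>A copy of the type of bounded linear functions, which cannot be an instance of an algebra class
  itself because its domain and codomain are independent type parameters.\<close>

typedef (overloaded) ('a::euclidean_space) endo = "UNIV :: ('a \<Rightarrow>\<^sub>L 'a) set"
  morphisms blinfun_of_endo Endo ..

setup_lifting type_definition_endo

instantiation endo :: (euclidean_space) real_normed_algebra_1
begin

lift_definition zero_endo :: "'a endo" is 0 .
lift_definition one_endo :: "'a endo" is id_blinfun .
lift_definition plus_endo :: "'a endo \<Rightarrow> 'a endo \<Rightarrow> 'a endo" is "(+)" .
lift_definition minus_endo :: "'a endo \<Rightarrow> 'a endo \<Rightarrow> 'a endo" is "(-)" .
lift_definition uminus_endo :: "'a endo \<Rightarrow> 'a endo" is uminus .
lift_definition times_endo :: "'a endo \<Rightarrow> 'a endo \<Rightarrow> 'a endo" is "(o\<^sub>L)" .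
lift_definition scaleR_endo :: "real \<Rightarrow> 'a endo \<Rightarrow> 'a endo" is scaleR .
lift_definition norm_endo :: "'a endo \<Rightarrow> real" is norm .
definition dist_endo :: "'a endo \<Rightarrow> 'a endo \<Rightarrow> real" where "dist_endo S T = norm (S - T)"
definition uniformity_endo :: "('a endo \<times> 'a endo) filter" where
  "uniformity_endo = (INF e\<in>{0<..}. principal {(S, T). dist S T < e})"
definition open_endo :: "'a endo set \<Rightarrow> bool" where
  "open_endo U \<longleftrightarrow> (\<forall>S\<in>U. \<forall>\<^sub>F (S', T) in uniformity. S' = S \<longrightarrow> T \<in> U)"
definition sgn_endo :: "'a endo \<Rightarrow> 'a endo" where "sgn_endo S = scaleR (inverse (norm S)) S"

instance
proof
  fix S T R :: "'a endo" and a b :: real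
  show "norm (S + T) \<le> norm S + norm T" by transfer (rule norm_triangle_ineq)
  show "norm (S * T) \<le> norm S * norm T" by transfer (rule norm_blinfun_compose)
  show "norm (1 :: 'a endo) = 1" by transfer simp
  show "(0 :: 'a endo) \<noteq> 1"
    by transfer (metis norm_blinfun_id norm_zero zero_neq_one)
  show "(S + T) * R = S * R + T * R" "S * (T + R) = S * T + S * R"
    by (transfer, rule blinfun_eqI, simp add: blinfun.bilinear_simps)+
  show "a *\<^sub>R S * T = a *\<^sub>R (S * T)" "S * a *\<^sub>R T = a *\<^sub>R (S * T)"
    by (transfer, rule blinfun_eqI, simp add: blinfun.bilinear_simps)+
  show "S * T * R = S * (T * R)" "1 * S = S" "S * 1 = S"
    by (transfer, rule blinfun_eqI, simp)+
  show "norm (a *\<^sub>R S) = \<bar>a\<bar> * norm S" by transfer simp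
  show "(norm S = 0) = (S = 0)" by transfer simp
  show "S + T + R = S + (T + R)" "S + T = T + S" "0 + S = S" "- S + S = 0" "S - T = S + - T"
    "a *\<^sub>R (S + T) = a *\<^sub>R S + a *\<^sub>R T" "(a + b) *\<^sub>R S = a *\<^sub>R S + b *\<^sub>R S"
    "a *\<^sub>R b *\<^sub>R S = (a * b) *\<^sub>R S" "1 *\<^sub>R S = S"
    by (transfer, simp add: algebra_simps)+
qed (rule dist_endo_def uniformity_endo_def open_endo_def sgn_endo_def)+

end

text \<open>Completeness makes the power series \<open>exp\<close> available for
  endomorphisms.\<close>

instance endo :: (euclidean_space) banach
proof
  fix X :: "nat \<Rightarrow> 'a endo" assume "Cauchy X"
  then have "Cauchy (\<lambda>n. blinfun_of_endo (X n))"
    by (simp add: Cauchy_def dist_norm norm_endo.rep_eq minus_endo.rep_eq)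
  then obtain L where "(\<lambda>n. blinfun_of_endo (X n)) \<longlonglongrightarrow> L"
    using Cauchy_convergent convergent_def by blast
  then have "X \<longlonglongrightarrow> Endo L"
    by (simp add: tendsto_iff dist_norm norm_endo.rep_eq minus_endo.rep_eq Endo_inverse)
  then show "convergent X" by (auto simp: convergent_def)
qed

subsection \<open>The derivative of the exponential\<close>

text \<open>Duhamel's integral, the Frechet derivative of \<open>exp\<close> at \<open>F\<close> in
  the direction \<open>A\<close> (\<open>has_derivative_exp_algebra\<close>). It collapses to
  \<open>A * exp F\<close> when \<open>A\<close> and \<open>F\<close> commute.\<close>

definition dexp :: "'b \<Rightarrow> 'b \<Rightarrow> 'b::{real_normed_algebra_1, banach}" where
  "dexp F A = integral {0..1} (\<lambda>u. exp (u *\<^sub>R F) * A * exp ((1 - u) *\<^sub>R F))"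

text \<open>The two exponents are kept separate for two uses: \<open>A = 1\<close> gives the
  difference of two exponentials, and \<open>G = F\<close> turns differentiation in \<open>u\<close>
  into a commutator with \<open>F\<close>.\<close>

lemma has_vector_derivative_exp_sandwich:
  fixes F G A :: "'b::{real_normed_algebra_1, banach}"
  shows "((\<lambda>u. exp (u *\<^sub>R G) * A * exp ((1 - u) *\<^sub>R F)) has_vector_derivative
    exp (u *\<^sub>R G) * (G * A - A * F) * exp ((1 - u) *\<^sub>R F)) (at u within S)"
proof -
  have "((\<lambda>u. exp ((1 - u) *\<^sub>R F)) has_vector_derivative (- 1) *\<^sub>R (F * exp ((1 - u) *\<^sub>R F))) (at u within S)"
    by (rule vector_diff_chain_within[of "\<lambda>u. 1 - u" "-1" u S "\<lambda>t. exp (t *\<^sub>R F)", unfolded o_def])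
       (auto intro!: derivative_eq_intros has_vector_derivative_at_within[OF exp_scaleR_has_vector_derivative_left])
  then have "((\<lambda>u. (exp (u *\<^sub>R G) * A) * exp ((1 - u) *\<^sub>R F)) has_vector_derivative
    (exp (u *\<^sub>R G) * A) * ((- 1) *\<^sub>R (F * exp ((1 - u) *\<^sub>R F))) + (exp (u *\<^sub>R G) * G * A) * exp ((1 - u) *\<^sub>R F)) (at u within S)"
    by (intro bounded_bilinear.has_vector_derivative[OF bounded_bilinear_mult]
        bounded_linear.has_vector_derivative[OF bounded_linear_mult_left]
        exp_scaleR_has_vector_derivative_right)
  then show ?thesis by (simp add: algebra_simps)
qed

lemma continuous_on_exp_sandwich:
  "continuous_on S (\<lambda>u. exp (u *\<^sub>R G) * A * exp ((1 - u) *\<^sub>R (F :: 'b::{real_normed_algebra_1, banach})))"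
  unfolding continuous_on_eq_continuous_within
  by (intro ballI has_vector_derivative_continuous[OF has_vector_derivative_exp_sandwich])

lemma dexp_has_integral:
  "((\<lambda>u. exp (u *\<^sub>R F) * A * exp ((1 - u) *\<^sub>R F)) has_integral dexp F A) {0..1}"
  unfolding dexp_def by (intro integrable_integral integrable_continuous_interval continuous_on_exp_sandwich)

text \<open>The weights \<open>u\<close> and \<open>1 - u\<close> add up to 1, so the bound does not
  depend on \<open>u\<close>.\<close>

lemma norm_exp_sandwich_le:
  fixes F G A :: "'b::{real_normed_algebra_1, banach}"
  assumes "u \<in> {0..1}" "norm F \<le> r" "norm G \<le> r"
  shows "norm (exp (u *\<^sub>R G) * A * exp ((1 - u) *\<^sub>R F)) \<le> norm A * exp r"
proof -
  have "norm (exp (u *\<^sub>R G)) \<le> exp (u * r)" "norm (exp ((1 - u) *\<^sub>R F)) \<le> exp ((1 - u) * r)"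
    using assms by (auto intro!: order_trans[OF norm_exp] mult_left_mono)
  then have "norm (exp (u *\<^sub>R G)) * norm A * norm (exp ((1 - u) *\<^sub>R F)) \<le> exp (u * r) * norm A * exp ((1 - u) * r)"
    by (intro mult_mono mult_right_mono) auto
  also have "\<dots> = norm A * exp r" by (simp add: exp_add[symmetric] algebra_simps)
  finally show ?thesis
    by (meson norm_mult_ineq mult_right_mono norm_ge_zero order_trans)
qed

lemma dexp_norm_le: "norm (dexp F A) \<le> norm A * exp (norm F)"
  using has_integral_bound[of "norm A * exp (norm F)" _ "dexp F A" "0::real" 1]
    dexp_has_integral[of F A] norm_exp_sandwich_le[of _ F "norm F" F A] by simp

lemma bounded_linear_dexp: "bounded_linear (dexp F)"
proof (rule bounded_linear_intro[where K = "exp (norm F)"])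
  fix A B :: 'a and r :: real
  show "dexp F (A + B) = dexp F A + dexp F B"
    using has_integral_add[OF dexp_has_integral[of F A] dexp_has_integral[of F B]] dexp_has_integral[of F "A + B"]
    by (simp add: distrib_left distrib_right has_integral_unique)
  show "dexp F (r *\<^sub>R A) = r *\<^sub>R dexp F A"
    using has_integral_cmul[OF dexp_has_integral[of F A], of r] dexp_has_integral[of F "r *\<^sub>R A"]
    by (simp add: has_integral_unique)
  show "norm (dexp F A) \<le> norm A * exp (norm F)" by (rule dexp_norm_le)
qed

text \<open>The path exp(u G) exp((1 - u) F) joins exp F to exp G; its velocity is the
  integrand.\<close>

lemma exp_diff_has_integral:
  fixes F G :: "'b::{real_normed_algebra_1, banach}"
  shows "((\<lambda>u. exp (u *\<^sub>R G) * (G - F) * exp ((1 - u) *\<^sub>R F)) has_integral exp G - exp F) {0..1}"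
  using fundamental_theorem_of_calculus[of 0 1 "\<lambda>u. exp (u *\<^sub>R G) * 1 * exp ((1 - u) *\<^sub>R F)",
      OF _ has_vector_derivative_exp_sandwich] by simp

lemma norm_exp_diff_le:
  fixes F G :: "'b::{real_normed_algebra_1, banach}"
  assumes "norm F \<le> r" "norm G \<le> r"
  shows "norm (exp G - exp F) \<le> norm (G - F) * exp r"
  using has_integral_bound[of "norm (G - F) * exp r" _ "exp G - exp F" "0::real" 1]
    exp_diff_has_integral[of G F] norm_exp_sandwich_le[OF _ assms] by simp

text \<open>The integrals for \<open>exp G - exp F\<close> and for \<open>dexp F (G - F)\<close>
  differ only in the left factor, exp(u G) against exp(u F). That difference is itself of order
  \<open>norm (G - F)\<close>, so the remainder is quadratic.\<close>

lemma has_derivative_exp_algebra: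
  fixes F :: "'b::{real_normed_algebra_1, banach}"
  shows "(exp has_derivative dexp F) (at F)"
proof (rule has_derivativeI_sandwich[where e = 1 and H = "\<lambda>G. norm (G - F) * exp (2 * (norm F + 1))"])
  fix G assume G: "G \<noteq> F" "dist G F < 1"
  define r where "r = norm F + 1"
  have r: "norm F \<le> r" "norm G \<le> r"
    using G norm_triangle_ineq[of F "G - F"] by (auto simp: r_def dist_norm)
  have "((\<lambda>u. (exp (u *\<^sub>R G) - exp (u *\<^sub>R F)) * (G - F) * exp ((1 - u) *\<^sub>R F)) has_integral
      exp G - exp F - dexp F (G - F)) {0..1}"
    using has_integral_diff[OF exp_diff_has_integral[of G F] dexp_has_integral[of F "G - F"]]
    by (simp add: left_diff_distrib)
  moreover have "norm ((exp (u *\<^sub>R G) - exp (u *\<^sub>R F)) * (G - F) * exp ((1 - u) *\<^sub>R F))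
      \<le> (norm (G - F) * exp r) * norm (G - F) * exp r" if u: "u \<in> {0..1}" for u :: real
  proof -
    have ur: "norm (u *\<^sub>R F) \<le> r" "norm (u *\<^sub>R G) \<le> r" "norm ((1 - u) *\<^sub>R F) \<le> r"
      using u r by (auto intro!: order_trans[OF mult_left_le_one_le])
    have "norm (exp (u *\<^sub>R G) - exp (u *\<^sub>R F)) \<le> norm (u *\<^sub>R G - u *\<^sub>R F) * exp r"
      by (rule norm_exp_diff_le[OF ur(1,2)])
    also have "norm (u *\<^sub>R G - u *\<^sub>R F) \<le> norm (G - F)"
      using u by (auto simp flip: scaleR_diff_right intro!: mult_left_le_one_le)
    finally have 1: "norm (exp (u *\<^sub>R G) - exp (u *\<^sub>R F)) \<le> norm (G - F) * exp r" by simp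
    have "norm (exp ((1 - u) *\<^sub>R F)) \<le> exp r"
      using norm_exp[of "(1 - u) *\<^sub>R F"] ur(3) by (meson exp_le_cancel_iff order_trans)
    with 1 have "norm (exp (u *\<^sub>R G) - exp (u *\<^sub>R F)) * norm (G - F) * norm (exp ((1 - u) *\<^sub>R F))
        \<le> (norm (G - F) * exp r) * norm (G - F) * exp r"
      by (intro mult_mono mult_right_mono) auto
    then show ?thesis by (meson norm_mult_ineq mult_right_mono norm_ge_zero order_trans)
  qed
  ultimately have "norm (exp G - exp F - dexp F (G - F)) \<le> (norm (G - F) * exp r) * norm (G - F) * exp r"
    using has_integral_bound[of "(norm (G - F) * exp r) * norm (G - F) * exp r" _
        "exp G - exp F - dexp F (G - F)" "0::real" 1] by simp
  moreover have "exp (2 * (norm F + 1)) = exp r * exp r"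
    unfolding r_def by (simp only: mult_2 exp_add)
  ultimately show "norm (exp G - exp F - dexp F (G - F)) / norm (G - F) \<le> norm (G - F) * exp (2 * (norm F + 1))"
    using G by (simp add: divide_le_eq ac_simps)
next
  have "((\<lambda>G. norm (G - F) * exp (2 * (norm F + 1))) \<longlongrightarrow> norm (F - F) * exp (2 * (norm F + 1))) (at F)"
    by (intro tendsto_intros)
  then show "((\<lambda>G. norm (G - F) * exp (2 * (norm F + 1))) \<longlongrightarrow> 0) (at F)" by simp
qed (auto intro: bounded_linear_dexp)

lemma continuous_on_exp_algebra: "continuous_on S (exp :: 'b::{real_normed_algebra_1, banach} \<Rightarrow> 'b)"
  using has_derivative_exp_algebra has_derivative_continuous
  by (blast intro: continuous_at_imp_continuous_on)

text \<open>Supplies the continuous partial derivatives that \<open>exp_C1\<close> demands of the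
  entries of the exponential.\<close>

lemma continuous_on_dexp:
  fixes F A :: "'x::topological_space \<Rightarrow> 'b::{real_normed_algebra_1, banach}"
  assumes "continuous_on S F" "continuous_on S A"
  shows "continuous_on S (\<lambda>x. dexp (F x) (A x))"
proof -
  have "continuous_on (S \<times> cbox 0 1)
      (\<lambda>(x, u). exp (u *\<^sub>R F x) * A x * exp ((1 - u) *\<^sub>R F x))"
    unfolding case_prod_unfold
    by (intro continuous_on_mult continuous_on_compose2[OF continuous_on_exp_algebra[of UNIV]]
        continuous_on_scaleR continuous_on_diff continuous_on_const continuous_on_snd continuous_on_id
        continuous_on_compose2[OF assms(1)] continuous_on_compose2[OF assms(2)] continuous_on_fst) auto
  from integral_continuous_on_param[OF this] show ?thesis by (simp add: dexp_def)
qed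

subsection \<open>The Hilbert--Schmidt inner product\<close>

lift_definition app :: "'a::euclidean_space endo \<Rightarrow> 'a \<Rightarrow> 'a" is blinfun_apply .

lemma bounded_bilinear_app: "bounded_bilinear app"
proof
  fix S T :: "'a endo" and a b :: 'a and r :: real
  show "app (S + T) a = app S a + app T a" "app S (a + b) = app S a + app S b"
    "app (r *\<^sub>R S) a = r *\<^sub>R app S a" "app S (r *\<^sub>R a) = r *\<^sub>R app S a"
    by (transfer, simp add: blinfun.bilinear_simps)+
  show "\<exists>K. \<forall>S (a :: 'a). norm (app S a) \<le> norm S * norm a * K"
    by (intro exI[of _ 1], transfer, simp add: norm_blinfun)
qed

interpretation app: bounded_bilinear app by (rule bounded_bilinear_app)

lemma norm_app: "norm (app S x) \<le> norm S * norm x"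
  by transfer (rule norm_blinfun)

lemma app_mult[simp]: "app (S * T) x = app S (app T x)"
  by transfer simp

lemma app_one[simp]: "app 1 x = x"
  by transfer simp

lemma app_expand: "app S x = (\<Sum>c\<in>Basis. (x \<bullet> c) *\<^sub>R app S c)"
proof -
  have "app S x = app S (\<Sum>c\<in>Basis. (x \<bullet> c) *\<^sub>R c)" by (simp add: euclidean_representation)
  then show ?thesis by (simp add: app.sum_right app.scaleR_right)
qed

text \<open>The trace of the adjoint of \<open>S\<close> times \<open>T\<close>; in particular
  \<open>hs 1 T\<close> is the trace of \<open>T\<close>. Cyclicity of the trace takes the form of
  moving selfadjoint factors across, on the left or on the right.\<close>

definition hs :: "'a::euclidean_space endo \<Rightarrow> 'a endo \<Rightarrow> real" where
  "hs S T = (\<Sum>b\<in>Basis. app S b \<bullet> app T b)"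

lemma abs_hs_le: "\<bar>hs S T\<bar> \<le> real DIM('a) * (norm S * norm (T :: 'a::euclidean_space endo))"
proof -
  have "norm (hs S T) \<le> (\<Sum>b\<in>(Basis::'a set). norm S * norm T)"
    unfolding hs_def
  proof (rule sum_norm_le)
    fix b :: 'a assume "b \<in> Basis"
    then show "norm (app S b \<bullet> app T b) \<le> norm S * norm T"
      using norm_app[of S b] norm_app[of T b] Cauchy_Schwarz_ineq2[of "app S b" "app T b"]
        mult_mono[of "norm (app S b)" "norm S" "norm (app T b)" "norm T"] by simp
  qed
  then show ?thesis by simp
qed

lemma bounded_bilinear_hs: "bounded_bilinear hs"
proof
  fix S S' T T' :: "'a endo" and r :: real
  show "hs (S + S') T = hs S T + hs S' T" "hs S (T + T') = hs S T + hs S T'"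
    "hs (r *\<^sub>R S) T = r *\<^sub>R hs S T" "hs S (r *\<^sub>R T) = r *\<^sub>R hs S T"
    by (simp_all add: hs_def app.add_left app.scaleR_left inner_add_left inner_add_right
        sum.distrib sum_distrib_left)
  show "\<exists>K. \<forall>S T :: 'a endo. norm (hs S T) \<le> norm S * norm T * K"
    unfolding real_norm_def mult.commute[of "norm _ * norm _"]
    by (intro exI[of _ "real DIM('a)"] allI abs_hs_le)
qed

interpretation hs: bounded_bilinear hs by (rule bounded_bilinear_hs)

lemma hs_commute: "hs S T = hs T S"
  by (simp add: hs_def inner_commute)

lemma hs_self_nonneg: "0 \<le> hs S S"
  by (simp add: hs_def sum_nonneg)

text \<open>Cauchy-Schwarz in its arithmetic mean form, which is additive and can therefore be
  summed over directions.\<close>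

lemma hs_le: "hs S T \<le> (hs S S + hs T T) / 2"
  using hs_self_nonneg[of "S - T"] by (simp add: hs.diff_left hs.diff_right hs_commute[of T S])

lemma hs_expand: "hs S T = (\<Sum>b\<in>Basis. \<Sum>c\<in>Basis. (app S b \<bullet> c) * (app T b \<bullet> c))"
  unfolding hs_def by (subst euclidean_inner) simp

definition selfadj :: "'a::euclidean_space endo \<Rightarrow> bool" where
  "selfadj S \<longleftrightarrow> (\<forall>x y. app S x \<bullet> y = x \<bullet> app S y)"

lemma selfadjD: "selfadj S \<Longrightarrow> app S x \<bullet> y = x \<bullet> app S y"
  by (simp add: selfadj_def)

lemma selfadj_one: "selfadj 1" by (simp add: selfadj_def)
lemma selfadj_scaleR: "selfadj S \<Longrightarrow> selfadj (r *\<^sub>R S)"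
  by (simp add: selfadj_def app.scaleR_left)
lemma selfadj_diff: "selfadj S \<Longrightarrow> selfadj T \<Longrightarrow> selfadj (S - T)"
  by (simp add: selfadj_def app.diff_left inner_diff_left inner_diff_right)

lemma selfadj_power: "selfadj S \<Longrightarrow> selfadj (S ^ n)"
proof (induction n)
  case (Suc n)
  then show ?case
    unfolding selfadj_def by (simp add: power_commutes[symmetric] flip: app_mult) (metis app_mult power_commutes)
qed (simp add: selfadj_one)

lemma selfadj_exp:
  assumes "selfadj S" shows "selfadj (exp S)"
  unfolding selfadj_def
proof (intro allI)
  fix x y
  have 1: "(\<lambda>n. app (S ^ n /\<^sub>R fact n) x \<bullet> y) sums (app (exp S) x \<bullet> y)"
    by (intro bounded_linear.sums[OF bounded_linear_inner_left] bounded_linear.sums[OF app.bounded_linear_left] exp_converges)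
  have 2: "(\<lambda>n. x \<bullet> app (S ^ n /\<^sub>R fact n) y) sums (x \<bullet> app (exp S) y)"
    by (intro bounded_linear.sums[OF bounded_linear_inner_right] bounded_linear.sums[OF app.bounded_linear_left] exp_converges)
  have "app (S ^ n /\<^sub>R fact n) x \<bullet> y = x \<bullet> app (S ^ n /\<^sub>R fact n) y" for n
    by (intro selfadjD selfadj_scaleR selfadj_power assms)
  with 1 2 show "app (exp S) x \<bullet> y = x \<bullet> app (exp S) y"
    by (simp add: sums_unique2)
qed

lemma hs_mult_left: "selfadj S \<Longrightarrow> hs (S * T) U = hs T (S * U)"
  by (simp add: hs_def selfadjD)

text \<open>Not a termwise identity, in contrast to the left factor: \<open>app S b\<close> is
  expanded in the basis, and the two sums are exchanged by symmetry of the matrix of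
  \<open>S\<close>.\<close>

lemma hs_mult_right:
  assumes "selfadj S" shows "hs (T * S) U = hs T (U * S)"
proof -
  have "hs (T * S) U = (\<Sum>b\<in>Basis. \<Sum>c\<in>Basis. (app S b \<bullet> c) * (app T c \<bullet> app U b))"
    unfolding hs_def app_mult by (subst app_expand[of T]) (simp add: inner_sum_left)
  also have "\<dots> = (\<Sum>c\<in>Basis. \<Sum>b\<in>Basis. (app S c \<bullet> b) * (app T c \<bullet> app U b))"
    by (subst sum.swap, intro sum.cong refl arg_cong2[of _ _ _ _ "(*)"]) (metis selfadjD assms inner_commute)
  also have "\<dots> = hs T (U * S)"
    unfolding hs_def app_mult by (subst (2) app_expand[of U]) (simp add: inner_sum_right)
  finally show ?thesis .
qed

text \<open>By cyclicity both sides are the trace of \<open>A * A * N * N\<close>. This equates the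
  endpoint values in the convexity argument.\<close>

lemma hs_mult_swap:
  assumes "selfadj A" "selfadj N" shows "hs (N * A) (N * A) = hs (A * N) (A * N)"
  using assms by (simp add: hs_mult_right hs_mult_left[symmetric] mult.assoc) (metis hs_mult_left hs_mult_right mult.assoc)

lemma exp_half_mult: "exp ((u / 2) *\<^sub>R F) * exp ((u / 2) *\<^sub>R F) = exp (u *\<^sub>R (F :: 'a::{real_normed_algebra_1, banach}))"
  by (simp add: exp_add_commuting[symmetric] scaleR_add_left[symmetric])

lemma exp_scaleR_commute: "F * exp (u *\<^sub>R F) = exp (u *\<^sub>R F) * (F :: 'a::{real_normed_algebra_1, banach})"
  by (metis exp_times_arg_commute exp_times_scaleR_commute)

definition sandwich :: "'a::{real_normed_algebra_1, banach} \<Rightarrow> real \<Rightarrow> 'a \<Rightarrow> 'a" where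
  "sandwich F u A = exp (u *\<^sub>R F) * A * exp ((1 - u) *\<^sub>R F)"

text \<open>Halving each exponential exhibits the form in \<open>B\<close> and \<open>A\<close> as
  an inner product of their images under one linear map. It is thus positive semidefinite for every
  \<open>u\<close>, and Cauchy-Schwarz applies to it.\<close>

lemma hs_sandwich_split:
  assumes F: "selfadj F"
  shows "hs B (sandwich F u A) = hs (exp ((u / 2) *\<^sub>R F) * B * exp (((1 - u) / 2) *\<^sub>R F))
    (exp ((u / 2) *\<^sub>R F) * A * exp (((1 - u) / 2) *\<^sub>R F))"
proof -
  let ?P = "exp ((u / 2) *\<^sub>R F)" and ?Q = "exp (((1 - u) / 2) *\<^sub>R F)"
  have PQ: "selfadj ?P" "selfadj ?Q" by (intro selfadj_exp selfadj_scaleR F)+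
  have "hs (?P * B * ?Q) (?P * A * ?Q) = hs B (?P * (?P * A * ?Q) * ?Q)"
    by (simp add: hs_mult_left[OF PQ(1)] hs_mult_right[OF PQ(2)] mult.assoc)
  also have "?P * (?P * A * ?Q) * ?Q = (?P * ?P) * A * (?Q * ?Q)" by (simp add: mult.assoc)
  also have "\<dots> = sandwich F u A" unfolding exp_half_mult sandwich_def ..
  finally show ?thesis ..
qed

text \<open>The function of \<open>u\<close> is convex because its second derivative is the squared Hilbert--Schmidt
  norm of a commutator; it takes the same value at 0 and at 1.\<close>

lemma hs_sandwich_self_le:
  assumes F: "selfadj F" and A: "selfadj A" and u: "0 \<le> u" "u \<le> 1"
  shows "hs A (sandwich F u A) \<le> hs (A * exp ((1 / 2) *\<^sub>R F)) (A * exp ((1 / 2) *\<^sub>R F))"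
proof -
  define C where "C = F * A - A * F"
  define h where "h T u = hs A (sandwich F u T)" for T u
  have der: "(h T has_real_derivative h (F * T - T * F) u) (at u)" for T u
    unfolding h_def sandwich_def has_real_derivative_iff_has_vector_derivative
    by (intro bounded_linear.has_vector_derivative[OF hs.bounded_linear_right] has_vector_derivative_exp_sandwich)
  \<comment> \<open>Taking commutators with \<open>F\<close> is symmetric for \<open>hs\<close> and
    commutes with multiplication by \<open>?P\<close> on the left and \<open>?Q\<close> on the
    right, which are functions of \<open>F\<close>. One of the two commutators thus moves to the
    other argument and a square remains.\<close>
  have "h (F * C - C * F) u \<ge> 0" for u
  proof -
    let ?P = "exp ((u / 2) *\<^sub>R F)" and ?Q = "exp (((1 - u) / 2) *\<^sub>R F)"
    define X where "X = ?P * A * ?Q"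
    define Z where "Z = ?P * C * ?Q"
    have comm: "?P * (F * T - T * F) * ?Q = F * (?P * T * ?Q) - (?P * T * ?Q) * F" for T
    proof -
      have "F * (?P * T * ?Q) = (F * ?P) * T * ?Q" by (simp add: mult.assoc)
      moreover have "(?P * T * ?Q) * F = ?P * (T * F) * ?Q" by (simp add: mult.assoc exp_scaleR_commute)
      ultimately show ?thesis unfolding exp_scaleR_commute by (simp add: algebra_simps)
    qed
    have "h (F * C - C * F) u = hs X (F * Z - Z * F)"
      unfolding h_def hs_sandwich_split[OF F] comm X_def Z_def ..
    also have "\<dots> = hs (F * X - X * F) Z"
      by (simp add: hs.diff_left hs.diff_right hs_mult_left[OF F] hs_mult_right[OF F])
    also have "F * X - X * F = Z" unfolding X_def Z_def C_def comm ..
    finally show ?thesis by (simp add: hs_self_nonneg)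
  qed
  then have conv: "convex_on UNIV (h A)"
    by (intro f''_ge0_imp_convex[where f' = "h C" and f'' = "h (F * C - C * F)"]) (auto simp: der C_def)
  have N: "exp ((1 / 2) *\<^sub>R F) * exp ((1 / 2) *\<^sub>R F) = exp F"
    using exp_half_mult[of 1 F] by simp
  have saN: "selfadj (exp ((1 / 2) *\<^sub>R F))" by (intro selfadj_exp selfadj_scaleR F)
  have "h A 0 = hs (A * exp ((1 / 2) *\<^sub>R F)) (A * exp ((1 / 2) *\<^sub>R F))"
    by (simp add: h_def sandwich_def hs_mult_right[OF saN] mult.assoc N)
  moreover have "h A 1 = hs (exp ((1 / 2) *\<^sub>R F) * A) (exp ((1 / 2) *\<^sub>R F) * A)"
    unfolding hs_mult_left[OF saN] by (simp add: h_def sandwich_def N flip: mult.assoc)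
  moreover have "h A u \<le> (1 - u) * h A 0 + u * h A 1"
    using convex_onD[OF conv, of u 0 1] u by simp
  ultimately show ?thesis
    using hs_mult_swap[OF A saN] by (simp add: h_def algebra_simps)
qed

text \<open>Cauchy-Schwarz at each \<open>u\<close> leaves two diagonal terms, and convexity bounds
  each by its common endpoint value. The bound no longer mixes \<open>A\<close> with
  \<open>B\<close>, so \<open>B\<close> may come from a different point of the space than
  \<open>F\<close> and \<open>A\<close>.\<close>

lemma hs_dexp_le:
  assumes F: "selfadj F" and A: "selfadj A" and B: "selfadj B"
  defines "N \<equiv> exp ((1 / 2) *\<^sub>R F)"
  shows "hs B (dexp F A) \<le> (hs (A * N) (A * N) + hs (B * N) (B * N)) / 2"
proof -
  have "((\<lambda>u. hs B (sandwich F u A)) has_integral hs B (dexp F A)) {0..1}"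
    using has_integral_linear[OF dexp_has_integral hs.bounded_linear_right] by (simp add: o_def sandwich_def)
  moreover have "((\<lambda>u::real. (hs (A * N) (A * N) + hs (B * N) (B * N)) / 2) has_integral
      (hs (A * N) (A * N) + hs (B * N) (B * N)) / 2) {0..1}"
    using has_integral_const_real[of _ 0 1] by simp
  moreover have "hs B (sandwich F u A) \<le> (hs (A * N) (A * N) + hs (B * N) (B * N)) / 2" if "u \<in> {0..1}" for u
  proof -
    have "hs B (sandwich F u A) \<le> (hs B (sandwich F u B) + hs A (sandwich F u A)) / 2"
      unfolding hs_sandwich_split[OF F] by (rule hs_le)
    also have "\<dots> \<le> (hs (A * N) (A * N) + hs (B * N) (B * N)) / 2"
      using hs_sandwich_self_le[OF F A, of u] hs_sandwich_self_le[OF F B, of u] that by (simp add: N_def)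
    finally show ?thesis .
  qed
  ultimately show ?thesis by (rule has_integral_le)
qed

lemma hs_exp_half:
  assumes "selfadj F"
  shows "hs (exp ((1 / 2) *\<^sub>R F)) (exp ((1 / 2) *\<^sub>R F)) = hs 1 (exp F)"
proof -
  have "hs (exp ((1 / 2) *\<^sub>R F) * 1) (exp ((1 / 2) *\<^sub>R F)) = hs 1 (exp F)"
    unfolding hs_mult_left[OF selfadj_exp[OF selfadj_scaleR[OF assms]]]
    using exp_half_mult[of 1 F] by simp
  then show ?thesis by simp
qed

subsection \<open>The trace moment generating function\<close>

lemma norm_endo_le: "0 \<le> K \<Longrightarrow> (\<And>z. norm (app S z) \<le> K * norm z) \<Longrightarrow> norm S \<le> K"
  by transfer (rule norm_blinfun_bound)

lemma bounded_linear_app_inner: "bounded_linear (\<lambda>S. app S b \<bullet> c)"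
  by (intro bounded_linear_compose[OF bounded_linear_inner_left app.bounded_linear_left])

lemma abs_app_inner_le: "b \<in> Basis \<Longrightarrow> c \<in> Basis \<Longrightarrow> \<bar>app S b \<bullet> c\<bar> \<le> norm S"
  using norm_app[of S b] Basis_le_norm[of c "app S b"] by simp

text \<open>The hypothesis is a bound on quadratic forms; it is applied to each vector
  \<open>app N b\<close>.\<close>

lemma hs_mult_sum_le:
  assumes "\<And>z. (\<Sum>i\<in>I. (norm (app (A i) z))\<^sup>2) \<le> v * (norm z)\<^sup>2"
  shows "(\<Sum>i\<in>I. hs (A i * N) (A i * N)) \<le> v * hs N N"
proof -
  have "(\<Sum>i\<in>I. hs (A i * N) (A i * N)) = (\<Sum>b\<in>Basis. \<Sum>i\<in>I. (norm (app (A i) (app N b)))\<^sup>2)"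
    unfolding hs_def app_mult power2_norm_eq_inner by (rule sum.swap)
  also have "\<dots> \<le> (\<Sum>b\<in>Basis. v * (norm (app N b))\<^sup>2)"
    by (intro sum_mono assms)
  finally show ?thesis
    by (simp add: hs_def power2_norm_eq_inner sum_distrib_left)
qed

text \<open>Symmetry is a family of linear equations between entries, and derivatives are
  unique.\<close>

lemma selfadj_derivative:
  assumes der: "(F has_derivative F') (at x)" and sa: "\<And>x. selfadj (F x)"
  shows "selfadj (F' h)"
  unfolding selfadj_def
proof (intro allI)
  fix a b
  have 1: "((\<lambda>x. app (F x) a \<bullet> b) has_derivative (\<lambda>h. app (F' h) a \<bullet> b)) (at x)"
    by (rule bounded_linear.has_derivative[OF bounded_linear_app_inner der])
  have "app (F x) a \<bullet> b = app (F x) b \<bullet> a" for x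
    using selfadjD[OF sa, of x a b] by (simp add: inner_commute)
  moreover have "((\<lambda>x. app (F x) b \<bullet> a) has_derivative (\<lambda>h. app (F' h) b \<bullet> a)) (at x)"
    by (rule bounded_linear.has_derivative[OF bounded_linear_app_inner der])
  ultimately have "((\<lambda>x. app (F x) a \<bullet> b) has_derivative (\<lambda>h. app (F' h) b \<bullet> a)) (at x)"
    by simp
  from has_derivative_unique[OF 1 this] have "app (F' h) a \<bullet> b = app (F' h) b \<bullet> a"
    by (simp add: fun_eq_iff)
  then show "app (F' h) a \<bullet> b = a \<bullet> app (F' h) b" by (simp add: inner_commute)
qed

text \<open>Since the derivatives are selfadjoint, \<open>var\<close> is the operator inequality
  that the sum of the squared partial derivatives is at most \<open>v\<close>, in terms of quadratic
  forms. It also controls every partial derivative, which gives the Lipschitz bound.\<close>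

locale lipschitz_endo_fun =
  fixes F :: "'e::euclidean_space \<Rightarrow> 'v::euclidean_space endo"
    and F' :: "'e \<Rightarrow> 'e \<Rightarrow> 'v endo" and v :: real
  assumes der: "(F has_derivative F' x) (at x)"
    and cont: "i \<in> Basis \<Longrightarrow> continuous_on UNIV (\<lambda>x. F' x i)"
    and sa: "selfadj (F x)"
    and var: "(\<Sum>i\<in>Basis. (norm (app (F' x i) z))\<^sup>2) \<le> v * (norm z)\<^sup>2"
begin

lemma v_nonneg: "0 \<le> v"
proof -
  obtain z :: 'v where z: "z \<in> Basis" using nonempty_Basis by blast
  have "0 \<le> (\<Sum>i\<in>Basis. (norm (app (F' 0 i) z))\<^sup>2)" by (intro sum_nonneg) auto
  also have "\<dots> \<le> v" using var[of 0 z] z by simp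
  finally show ?thesis .
qed

lemma norm_deriv_Basis: "i \<in> Basis \<Longrightarrow> norm (F' x i) \<le> sqrt v"
proof (rule norm_endo_le)
  fix z assume i: "i \<in> Basis"
  have "(norm (app (F' x i) z))\<^sup>2 \<le> (\<Sum>i\<in>Basis. (norm (app (F' x i) z))\<^sup>2)"
    by (rule member_le_sum[OF i]) auto
  also have "\<dots> \<le> (sqrt v * norm z)\<^sup>2"
    using var[of x z] v_nonneg by (simp add: power_mult_distrib)
  finally show "norm (app (F' x i) z) \<le> sqrt v * norm z"
    using v_nonneg by (auto intro: power2_le_imp_le)
qed (use v_nonneg in simp)

text \<open>A crude Lipschitz constant. Its dimension factor is harmless because it enters only
  growth estimates, never the final bound.\<close>

definition K :: real where "K = real DIM('e) * sqrt v"

lemma norm_deriv: "norm (F' x h) \<le> K * norm h"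
proof -
  interpret linear "F' x" using der by (rule has_derivative_linear)
  have "F' x h = F' x (\<Sum>i\<in>Basis. (h \<bullet> i) *\<^sub>R i)" by (simp add: euclidean_representation)
  also have "\<dots> = (\<Sum>i\<in>Basis. (h \<bullet> i) *\<^sub>R F' x i)" by (simp add: sum scale)
  also have "norm \<dots> \<le> (\<Sum>i\<in>(Basis::'e set). norm h * sqrt v)"
    by (intro sum_norm_le) (auto intro!: mult_mono Basis_le_norm norm_deriv_Basis)
  finally show ?thesis by (simp add: K_def mult_ac)
qed

lemma norm_F_le: "norm (F x) \<le> norm (F 0) + K * norm x"
proof -
  have "norm (F x - F 0) \<le> K * norm (x - 0)"
    by (rule differentiable_bound[of UNIV F F'])
       (auto intro: der onorm_le norm_deriv)
  then show ?thesis using norm_triangle_ineq2[of "F x" "F 0"] by simp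
qed

lemma exp_bdd_exp_norm_F: "exp_bdd (\<lambda>x. exp (\<theta> * norm (F x)))"
proof (rule exp_bddI)
  fix x
  have "\<theta> * norm (F x) \<le> \<bar>\<theta>\<bar> * (norm (F 0) + K * norm x)"
    using norm_F_le[of x] by (intro mult_mono) auto
  then show "norm (exp (\<theta> * norm (F x))) \<le> exp (\<bar>\<theta>\<bar> * norm (F 0)) * exp ((\<bar>\<theta>\<bar> * K) * norm x)"
    by (simp add: exp_add[symmetric] algebra_simps)
qed

lemma exp_bdd_F: "exp_bdd F"
  by (rule exp_bdd_mono[OF exp_bdd_exp_norm_F[of 1]])
     (use exp_ge_add_one_self[of "norm (F _)"] in \<open>simp, smt (verit)\<close>)

lemma exp_bdd_exp_F: "exp_bdd (\<lambda>x. exp (\<theta> *\<^sub>R F x))"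
  by (rule exp_bdd_mono[OF exp_bdd_exp_norm_F[of "\<bar>\<theta>\<bar>"]])
     (use norm_exp[of "\<theta> *\<^sub>R F _"] in simp)

lemma continuous_F: "continuous_on UNIV F"
  using der by (meson continuous_at_imp_continuous_on has_derivative_continuous)

lemma continuous_exp_F: "continuous_on UNIV (\<lambda>x. exp (\<theta> *\<^sub>R F x))"
  by (intro continuous_on_compose2[OF continuous_on_exp_algebra[of UNIV]] continuous_intros continuous_F) auto

lemma exp_C1_entry:
  assumes "b \<in> Basis" "c \<in> Basis"
  shows "exp_C1 (\<lambda>x. app (F x) b \<bullet> c) (\<lambda>x h. app (F' x h) b \<bullet> c)"
  unfolding exp_C1_def
proof (intro conjI allI ballI)
  show "((\<lambda>x. app (F x) b \<bullet> c) has_derivative (\<lambda>h. app (F' x h) b \<bullet> c)) (at x)" for x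
    by (rule bounded_linear.has_derivative[OF bounded_linear_app_inner der])
  show "exp_bdd (\<lambda>x. app (F x) b \<bullet> c)"
    using exp_bdd_F by (rule exp_bdd_mono) (simp add: abs_app_inner_le assms)
  fix i :: 'e assume i: "i \<in> Basis"
  show "continuous_on UNIV (\<lambda>x. app (F' x i) b \<bullet> c)"
    by (rule bounded_linear.continuous_on[OF bounded_linear_app_inner cont[OF i]])
  show "exp_bdd (\<lambda>x. app (F' x i) b \<bullet> c)"
    by (rule exp_bdd_mono[OF exp_bdd_const[of "sqrt v"]])
       (use order_trans[OF abs_app_inner_le[OF assms] norm_deriv_Basis[OF i]] v_nonneg in simp)
qed

lemma exp_C1_exp_entry:
  assumes "b \<in> Basis" "c \<in> Basis"
  shows "exp_C1 (\<lambda>x. app (exp (\<theta> *\<^sub>R F x)) b \<bullet> c) (\<lambda>x h. app (dexp (\<theta> *\<^sub>R F x) (\<theta> *\<^sub>R F' x h)) b \<bullet> c)"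
  unfolding exp_C1_def
proof (intro conjI allI ballI)
  show "((\<lambda>x. app (exp (\<theta> *\<^sub>R F x)) b \<bullet> c) has_derivative
      (\<lambda>h. app (dexp (\<theta> *\<^sub>R F x) (\<theta> *\<^sub>R F' x h)) b \<bullet> c)) (at x)" for x
    by (intro bounded_linear.has_derivative[OF bounded_linear_app_inner]
          has_derivative_compose[OF _ has_derivative_exp_algebra] has_derivative_scaleR_right der)
  show "exp_bdd (\<lambda>x. app (exp (\<theta> *\<^sub>R F x)) b \<bullet> c)"
    using exp_bdd_exp_F[of \<theta>] by (rule exp_bdd_mono) (simp add: abs_app_inner_le assms)
  fix i :: 'e assume i: "i \<in> Basis"
  show "continuous_on UNIV (\<lambda>x. app (dexp (\<theta> *\<^sub>R F x) (\<theta> *\<^sub>R F' x i)) b \<bullet> c)"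
    by (intro bounded_linear.continuous_on[OF bounded_linear_app_inner] continuous_on_dexp
          continuous_intros continuous_F cont[OF i])
  have "exp_bdd (\<lambda>x. (\<bar>\<theta>\<bar> * sqrt v) * exp (\<bar>\<theta>\<bar> * norm (F x)))"
    by (intro exp_bdd_mult exp_bdd_const exp_bdd_exp_norm_F)
  then show "exp_bdd (\<lambda>x. app (dexp (\<theta> *\<^sub>R F x) (\<theta> *\<^sub>R F' x i)) b \<bullet> c)"
  proof (rule exp_bdd_mono)
    fix x
    have "\<bar>app (dexp (\<theta> *\<^sub>R F x) (\<theta> *\<^sub>R F' x i)) b \<bullet> c\<bar> \<le> norm (\<theta> *\<^sub>R F' x i) * exp (norm (\<theta> *\<^sub>R F x))"
      by (rule order_trans[OF abs_app_inner_le[OF assms] dexp_norm_le])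
    also have "\<dots> \<le> (\<bar>\<theta>\<bar> * sqrt v) * exp (\<bar>\<theta>\<bar> * norm (F x))"
      using norm_deriv_Basis[OF i, of x] by (simp add: mult_left_mono mult_right_mono)
    finally show "norm (app (dexp (\<theta> *\<^sub>R F x) (\<theta> *\<^sub>R F' x i)) b \<bullet> c) \<le> norm ((\<bar>\<theta>\<bar> * sqrt v) * exp (\<bar>\<theta>\<bar> * norm (F x)))"
      using v_nonneg by (simp add: abs_mult)
  qed
qed

text \<open>The points \<open>x\<close> and \<open>z\<close> are independent of each other. After
  \<open>hs_dexp_le\<close> both halves carry the same weight \<open>N\<close>, taken at
  \<open>z\<close>, and \<open>var\<close> bounds each of them by \<open>v * hs N N\<close>; hence
  the right-hand side is free of \<open>x\<close>.\<close>

lemma hs_gradient_le: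
  assumes "0 \<le> \<theta>"
  shows "(\<Sum>i\<in>Basis. hs (F' x i) (dexp (\<theta> *\<^sub>R F z) (\<theta> *\<^sub>R F' z i))) \<le> \<theta> * v * hs 1 (exp (\<theta> *\<^sub>R F z))"
proof -
  define N where "N = exp ((1 / 2) *\<^sub>R (\<theta> *\<^sub>R F z))"
  have saF: "selfadj (\<theta> *\<^sub>R F z)" by (intro selfadj_scaleR sa)
  have "(\<Sum>i\<in>Basis. hs (F' x i) (dexp (\<theta> *\<^sub>R F z) (F' z i)))
      \<le> (\<Sum>i\<in>Basis. (hs (F' z i * N) (F' z i * N) + hs (F' x i * N) (F' x i * N)) / 2)"
    unfolding N_def by (intro sum_mono hs_dexp_le saF selfadj_derivative[OF der sa])
  also have "\<dots> = ((\<Sum>i\<in>Basis. hs (F' z i * N) (F' z i * N)) + (\<Sum>i\<in>Basis. hs (F' x i * N) (F' x i * N))) / 2"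
    by (simp add: sum.distrib sum_divide_distrib[symmetric])
  also have "\<dots> \<le> v * hs N N"
    using hs_mult_sum_le[of "F' z" Basis v N] hs_mult_sum_le[of "F' x" Basis v N] var by simp
  also have "hs N N = hs 1 (exp (\<theta> *\<^sub>R F z))"
    unfolding N_def by (rule hs_exp_half[OF saF])
  finally have "\<theta> * (\<Sum>i\<in>Basis. hs (F' x i) (dexp (\<theta> *\<^sub>R F z) (F' z i))) \<le> \<theta> * (v * hs 1 (exp (\<theta> *\<^sub>R F z)))"
    using assms by (rule mult_left_mono)
  then show ?thesis
    by (simp add: sum_distrib_left mult.assoc hs.scaleR_right linear_cmul[OF bounded_linear.linear[OF bounded_linear_dexp]])
qed

definition L :: "real \<Rightarrow> real" where "L \<theta> = (\<integral>x. hs 1 (exp (\<theta> *\<^sub>R F x)) \<partial>gauss)"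

lemma continuous_trace: "continuous_on UNIV (\<lambda>x. hs 1 (exp (\<theta> *\<^sub>R F x)))"
  by (intro bounded_linear.continuous_on[OF hs.bounded_linear_right] continuous_exp_F)

lemma exp_bdd_trace: "exp_bdd (\<lambda>x. hs 1 (exp (\<theta> *\<^sub>R F x)))"
  unfolding hs_expand using exp_C1D(2)[OF exp_C1_exp_entry[of _ _ \<theta>]]
  by (intro exp_bdd_sum exp_bdd_mult exp_bdd_const) auto

lemma integrable_trace: "integrable gauss (\<lambda>x. hs 1 (exp (\<theta> *\<^sub>R F x)))"
  by (intro integrable_gauss exp_bdd_trace borel_measurable_continuous_onI continuous_trace)

text \<open>The trace is a sum of products of scalar entries. The covariance estimate is applied to
  all entries at once, since the gradient bound holds only for their sum.\<close>

lemma trace_deriv_le: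
  assumes mean: "\<And>b c. b \<in> Basis \<Longrightarrow> c \<in> Basis \<Longrightarrow> (\<integral>x. app (F x) b \<bullet> c \<partial>gauss) = 0"
    and \<theta>: "0 \<le> \<theta>"
  shows "(\<integral>x. hs (F x) (exp (\<theta> *\<^sub>R F x)) \<partial>gauss) \<le> \<theta> * v * L \<theta>"
proof -
  define Q where "Q = (Basis :: 'v set) \<times> (Basis :: 'v set)"
  have hs_Q: "hs S T = (\<Sum>k\<in>Q. (app S (fst k) \<bullet> snd k) * (app T (fst k) \<bullet> snd k))" for S T :: "'v endo"
    by (simp add: hs_expand Q_def sum.cartesian_product case_prod_unfold)
  have int: "integrable gauss (\<lambda>x. (app (F x) b \<bullet> c) * (app (exp (\<theta> *\<^sub>R F x)) b \<bullet> c))"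
    if "b \<in> Basis" "c \<in> Basis" for b c
    by (intro integrable_gauss exp_bdd_mult exp_C1D(2)[OF exp_C1_entry[OF that]]
        exp_C1D(2)[OF exp_C1_exp_entry[OF that]] borel_measurable_continuous_onI continuous_on_mult
        exp_C1D(3)[OF exp_C1_entry[OF that]] exp_C1D(3)[OF exp_C1_exp_entry[OF that]])
  have "(\<integral>x. hs (F x) (exp (\<theta> *\<^sub>R F x)) \<partial>gauss)
      = (\<Sum>k\<in>Q. \<integral>x. (app (F x) (fst k) \<bullet> snd k) * (app (exp (\<theta> *\<^sub>R F x)) (fst k) \<bullet> snd k) \<partial>gauss)"
    unfolding hs_Q by (rule Bochner_Integration.integral_sum) (auto simp: Q_def int)
  also have "\<dots> \<le> (\<integral>x. \<theta> * v * hs 1 (exp (\<theta> *\<^sub>R F x)) \<partial>gauss)"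
  proof (rule gauss_covariance_le[where u' = "\<lambda>k x h. app (F' x h) (fst k) \<bullet> snd k"
        and g' = "\<lambda>k x h. app (dexp (\<theta> *\<^sub>R F x) (\<theta> *\<^sub>R F' x h)) (fst k) \<bullet> snd k"])
    fix x z
    have "(\<Sum>k\<in>Q. \<Sum>i\<in>Basis. (app (F' x i) (fst k) \<bullet> snd k) *
          (app (dexp (\<theta> *\<^sub>R F z) (\<theta> *\<^sub>R F' z i)) (fst k) \<bullet> snd k))
        = (\<Sum>i\<in>Basis. hs (F' x i) (dexp (\<theta> *\<^sub>R F z) (\<theta> *\<^sub>R F' z i)))"
      unfolding hs_Q by (rule sum.swap)
    also have "\<dots> \<le> \<theta> * v * hs 1 (exp (\<theta> *\<^sub>R F z))"
      by (rule hs_gradient_le[OF \<theta>])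
    finally show "(\<Sum>k\<in>Q. \<Sum>i\<in>Basis. (app (F' x i) (fst k) \<bullet> snd k) *
          (app (dexp (\<theta> *\<^sub>R F z) (\<theta> *\<^sub>R F' z i)) (fst k) \<bullet> snd k)) \<le> \<theta> * v * hs 1 (exp (\<theta> *\<^sub>R F z))" .
  qed (auto simp: Q_def intro!: exp_C1_entry exp_C1_exp_entry mean exp_bdd_mult exp_bdd_const
      exp_bdd_trace continuous_on_mult continuous_on_const continuous_trace)
  also have "\<dots> = \<theta> * v * L \<theta>" by (simp add: L_def)
  finally show ?thesis .
qed

text \<open>Along the ray \<theta> F the exponential commutes with \<open>F\<close>, so no Duhamel
  integral appears.\<close>

lemma L_derivative: "(L has_real_derivative (\<integral>x. hs (F x) (exp (\<theta> *\<^sub>R F x)) \<partial>gauss)) (at \<theta>)"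
  unfolding L_def[abs_def]
proof (rule has_real_derivative_integral[where r = 1
      and w = "\<lambda>x. real DIM('v) * (norm (F x) * exp ((\<bar>\<theta>\<bar> + 1) * norm (F x)))"
      and h' = "\<lambda>\<theta> x. hs (F x) (exp (\<theta> *\<^sub>R F x))"])
  fix s x
  show "integrable gauss (\<lambda>x. hs 1 (exp (s *\<^sub>R F x)))" by (rule integrable_trace)
  have "((\<lambda>s. hs 1 (exp (s *\<^sub>R F x))) has_vector_derivative hs 1 (F x * exp (s *\<^sub>R F x))) (at s)"
    by (intro bounded_linear.has_vector_derivative[OF hs.bounded_linear_right]
        exp_scaleR_has_vector_derivative_left)
  then show "((\<lambda>s. hs 1 (exp (s *\<^sub>R F x))) has_real_derivative hs (F x) (exp (s *\<^sub>R F x))) (at s)"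
    using hs_mult_left[OF sa, of x 1 "exp (s *\<^sub>R F x)"]
    by (simp add: has_real_derivative_iff_has_vector_derivative)
  assume s: "\<bar>s - \<theta>\<bar> < 1"
  have "norm (exp (s *\<^sub>R F x)) \<le> exp ((\<bar>\<theta>\<bar> + 1) * norm (F x))"
    using s by (intro order_trans[OF norm_exp]) (auto intro!: mult_right_mono)
  moreover have "\<bar>hs (F x) (exp (s *\<^sub>R F x))\<bar> \<le> real DIM('v) * (norm (F x) * norm (exp (s *\<^sub>R F x)))"
    by (rule abs_hs_le)
  ultimately show "\<bar>hs (F x) (exp (s *\<^sub>R F x))\<bar> \<le> real DIM('v) * (norm (F x) * exp ((\<bar>\<theta>\<bar> + 1) * norm (F x)))"
    by (meson mult_left_mono norm_ge_zero of_nat_0_le_iff order_trans)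
next
  show "integrable gauss (\<lambda>x. real DIM('v) * (norm (F x) * exp ((\<bar>\<theta>\<bar> + 1) * norm (F x))))"
    by (intro integrable_gauss exp_bdd_mult exp_bdd_const exp_bdd_exp_norm_F exp_bdd_mono[OF exp_bdd_F]
        borel_measurable_continuous_onI continuous_intros continuous_F) simp
qed simp

lemma L_le:
  assumes mean: "\<And>b c. b \<in> Basis \<Longrightarrow> c \<in> Basis \<Longrightarrow> (\<integral>x. app (F x) b \<bullet> c \<partial>gauss) = 0"
    and \<theta>: "0 \<le> \<theta>"
  shows "L \<theta> \<le> real DIM('v) * exp (\<theta>\<^sup>2 * v / 2)"
proof -
  \<comment> \<open>Gronwall's argument: the exponential is the integrating factor of L' \<le>
    \<theta> v L, so \<open>G\<close> cannot increase.\<close>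
  define G where "G s = L s * exp (- (s\<^sup>2 * v / 2))" for s
  have "G \<theta> \<le> G 0"
  proof (rule DERIV_nonpos_imp_nonincreasing[OF \<theta>])
    fix s assume s: "0 \<le> s" "s \<le> \<theta>"
    let ?D = "\<integral>x. hs (F x) (exp (s *\<^sub>R F x)) \<partial>gauss"
    have "(G has_real_derivative (?D - s * v * L s) * exp (- (s\<^sup>2 * v / 2))) (at s)"
    proof -
      have "((\<lambda>s. exp (- (s\<^sup>2 * v / 2))) has_real_derivative - (s * v) * exp (- (s\<^sup>2 * v / 2))) (at s)"
        by (auto intro!: derivative_eq_intros)
      from DERIV_mult[OF L_derivative this] show ?thesis
        unfolding G_def[abs_def] by (simp add: algebra_simps)
    qed
    moreover have "(?D - s * v * L s) * exp (- (s\<^sup>2 * v / 2)) \<le> 0"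
      using trace_deriv_le[OF mean s(1)] by (intro mult_nonpos_nonneg) auto
    ultimately show "\<exists>y. (G has_real_derivative y) (at s) \<and> y \<le> 0" by blast
  qed
  also have "G 0 = real DIM('v)"
    by (simp add: G_def L_def hs_def gauss.prob_space[unfolded space_gauss])
  finally have "L \<theta> * exp (- (\<theta>\<^sup>2 * v / 2)) * exp (\<theta>\<^sup>2 * v / 2) \<le> real DIM('v) * exp (\<theta>\<^sup>2 * v / 2)"
    unfolding G_def by (rule mult_right_mono) simp
  then show ?thesis by (simp add: mult.assoc exp_add[symmetric])
qed

end

subsection \<open>Hermitian matrices and the tail bound\<close>

lemma inj_axis_one: "inj (\<lambda>i. axis i (1 :: real) :: real ^ 'n)"
  by (rule injI) (simp add: axis_eq_axis)

lemma sum_Basis_vec: "(\<Sum>b\<in>Basis. h b) = (\<Sum>i\<in>UNIV. h (axis i 1))" for h :: "real ^ 'n \<Rightarrow> 'a::comm_monoid_add"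
proof -
  have "(Basis :: (real ^ 'n) set) = range (\<lambda>i. axis i 1)" by (auto simp: Basis_vec_def)
  then show ?thesis unfolding \<open>Basis = _\<close> by (simp add: sum.reindex[OF inj_axis_one])
qed

lemma prod_Basis_vec: "(\<Prod>b\<in>Basis. h b) = (\<Prod>i\<in>UNIV. h (axis i 1))" for h :: "real ^ 'n \<Rightarrow> 'a::comm_monoid_mult"
proof -
  have "(Basis :: (real ^ 'n) set) = range (\<lambda>i. axis i 1)" by (auto simp: Basis_vec_def)
  then show ?thesis unfolding \<open>Basis = _\<close> by (simp add: prod.reindex[OF inj_axis_one])
qed

text \<open>Open boxes generate the Borel sets and are stable under intersection, and on a box both
  measures are products over the coordinates.\<close>

lemma std_gaussian_eq_gauss: "std_gaussian = (gauss :: (real ^ 'n) measure)"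
proof (rule measure_eqI_generator_eq)
  let ?D = "density lborel (\<lambda>s. ennreal (std_normal_density s))"
  let ?E = "range (\<lambda>(a, b). box a b :: (real ^ 'n) set)"
  show "Int_stable ?E" by (auto simp: Int_stable_def box_Int_box)
  show "?E \<subseteq> Pow UNIV" "sets std_gaussian = sigma_sets UNIV ?E" "sets gauss = sigma_sets UNIV ?E"
    by (simp_all add: borel_eq_box std_gaussian_def)
  let ?A = "\<lambda>n::nat. box (- (real n *\<^sub>R One)) (real n *\<^sub>R One) :: (real ^ 'n) set"
  show "range ?A \<subseteq> ?E" "(\<Union>i. ?A i) = UNIV"
    unfolding UN_box_eq_UNIV by auto
  show "emeasure std_gaussian X = emeasure gauss X" if "X \<in> ?E" for X
  proof -
    from that obtain p where "X = (case p of (a, b) \<Rightarrow> box a b)" by blast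
    then obtain a b where X: "X = box a b" by (cases p) simp
    interpret D: prob_space ?D by (rule prob_space_normal_density) simp
    interpret P: product_sigma_finite "\<lambda>_ :: 'n. ?D"
      by (simp add: product_sigma_finite_def D.sigma_finite_measure_axioms)
    have meas: "(\<lambda>g. \<chi> i. g i) \<in> borel_measurable (\<Pi>\<^sub>M i\<in>UNIV. ?D)"
      by (subst borel_measurable_euclidean_space) (auto simp: Basis_vec_def inner_axis)
    have "emeasure std_gaussian X = emeasure (\<Pi>\<^sub>M i\<in>UNIV. ?D) (Pi\<^sub>E UNIV (\<lambda>i. {a $ i<..<b $ i}))"
      unfolding std_gaussian_def
      by (subst emeasure_distr[OF meas])
         (auto simp: X mem_box_cart space_PiM PiE_def Pi_def intro!: arg_cong[where f = "emeasure _"])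
    also have "\<dots> = (\<Prod>i\<in>UNIV. emeasure ?D {a $ i<..<b $ i})"
      by (rule P.emeasure_PiM) auto
    also have "\<dots> = (\<Prod>c\<in>Basis. \<integral>\<^sup>+s. indicator {a \<bullet> c<..<b \<bullet> c} s \<partial>?D)"
      unfolding prod_Basis_vec by (simp add: inner_axis)
    also have "\<dots> = (\<integral>\<^sup>+x. (\<Prod>c\<in>Basis. indicator {a \<bullet> c<..<b \<bullet> c} (x \<bullet> c)) \<partial>gauss)"
      by (rule nn_integral_gauss_prod[symmetric]) auto
    also have "(\<lambda>x. \<Prod>c\<in>Basis. indicator {a \<bullet> c<..<b \<bullet> c} (x \<bullet> c) :: ennreal) = indicator X"
      by (auto simp: fun_eq_iff X box_def split: split_indicator)
    finally show ?thesis by (simp add: X)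
  qed
  then have "emeasure std_gaussian (?A i) = emeasure gauss (?A i)" for i
    by (metis (no_types, lifting) case_prod_conv rangeI)
  then show "emeasure std_gaussian (?A i) \<noteq> \<infinity>" for i
    by simp
qed

section \<open>Eigenvalues of selfadjoint endomorphisms\<close>

text \<open>A maximiser \<open>x\<close> of the Rayleigh quotient is an eigenvector:
  \<open>T = l *\<^sub>R 1 - S\<close> is positive semidefinite and its form vanishes at
  \<open>x\<close>, which forces \<open>app T x = 0\<close>.\<close>

lemma selfadj_has_eigenvector:
  assumes S: "selfadj (S :: 'a::euclidean_space endo)"
  shows "\<exists>l x. x \<noteq> 0 \<and> app S x = l *\<^sub>R x"
proof -
  have "continuous_on (sphere 0 1) (\<lambda>x. app S x \<bullet> x)"
    by (intro continuous_intros bounded_linear.continuous_on[OF app.bounded_linear_right])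
  moreover have "sphere (0::'a) 1 \<noteq> {}"
    by (simp add: sphere_eq_empty)
  ultimately obtain x where "x \<in> sphere 0 1" and "\<forall>y\<in>sphere 0 1. app S y \<bullet> y \<le> app S x \<bullet> x"
    using continuous_attains_sup[OF compact_sphere] by blast
  then have x: "norm x = 1" and max: "\<And>y. norm y = 1 \<Longrightarrow> app S y \<bullet> y \<le> app S x \<bullet> x"
    by simp_all
  define l where "l = app S x \<bullet> x"
  define T where "T = l *\<^sub>R 1 - S"
  have T: "selfadj T" unfolding T_def by (intro selfadj_diff selfadj_scaleR selfadj_one S)
  have T_nonneg: "0 \<le> app T y \<bullet> y" for y
  proof (cases "y = 0")
    case False
    have "app S (y /\<^sub>R norm y) \<bullet> (y /\<^sub>R norm y) \<le> l"
      unfolding l_def using False by (intro max) simp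
    then have "app S y \<bullet> y \<le> l * (norm y)\<^sup>2"
      using False by (simp add: app.scaleR_right field_simps power2_eq_square)
    then show ?thesis
      by (simp add: T_def app.diff_left app.scaleR_left inner_diff_left power2_norm_eq_inner)
  qed (simp add: app.zero_right)
  define w where "w = app T x"
  have Tx: "app T x \<bullet> x = 0"
    using x by (simp add: T_def app.diff_left app.scaleR_left inner_diff_left l_def dot_square_norm)
  \<comment> \<open>Positivity is tested at \<open>x - s *\<^sub>R w\<close>, a small step against
    the gradient of the form; letting \<open>s\<close> tend to 0 from the right gives
    \<open>w = 0\<close>.\<close>
  have "2 * (w \<bullet> w) \<le> s * (app T w \<bullet> w)" if s: "0 < s" for s :: real
  proof -
    have "0 \<le> app T (x - s *\<^sub>R w) \<bullet> (x - s *\<^sub>R w)" by (rule T_nonneg)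
    also have "\<dots> = s * (s * (app T w \<bullet> w) - 2 * (w \<bullet> w))"
      using Tx selfadjD[OF T, of w x]
      by (simp add: app.diff_right app.scaleR_right inner_diff_left inner_diff_right w_def[symmetric]
          inner_commute algebra_simps)
    finally show ?thesis using s by (simp add: zero_le_mult_iff)
  qed
  then have "\<forall>\<^sub>F s in at_right 0. 2 * (w \<bullet> w) \<le> s * (app T w \<bullet> w)"
    by (auto simp: eventually_at_right_field intro: exI[of _ 1])
  moreover have "((\<lambda>s. s * (app T w \<bullet> w)) \<longlongrightarrow> 0 * (app T w \<bullet> w)) (at_right 0)"
    by (intro tendsto_intros)
  ultimately have "2 * (w \<bullet> w) \<le> 0"
    using tendsto_lowerbound[of "\<lambda>s. s * (app T w \<bullet> w)" _ "at_right 0"] by simp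
  then have "w \<bullet> w = 0" using inner_ge_zero[of w] by linarith
  then have "w = 0" by simp
  then have "app S x = l *\<^sub>R x" by (simp add: w_def T_def app.diff_left app.scaleR_left)
  moreover have "x \<noteq> 0" using x by auto
  ultimately show ?thesis by blast
qed

text \<open>Eigenvectors for distinct eigenvalues are orthogonal, hence independent.\<close>

lemma finite_eigenvalues:
  assumes S: "selfadj (S :: 'a::euclidean_space endo)"
  shows "finite {l. \<exists>x. x \<noteq> 0 \<and> app S x = l *\<^sub>R x}"
proof -
  define E where "E = {l. \<exists>x. x \<noteq> 0 \<and> app S x = l *\<^sub>R x}"
  have "\<forall>l\<in>E. \<exists>x. x \<noteq> 0 \<and> app S x = l *\<^sub>R x" by (simp add: E_def)
  then obtain e where e: "\<And>l. l \<in> E \<Longrightarrow> e l \<noteq> 0" "\<And>l. l \<in> E \<Longrightarrow> app S (e l) = l *\<^sub>R e l"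
    using bchoice[of E "\<lambda>l x. x \<noteq> 0 \<and> app S x = l *\<^sub>R x"] by blast
  have orth: "e l \<bullet> e m = 0" if "l \<in> E" "m \<in> E" "l \<noteq> m" for l m
  proof -
    have "l * (e l \<bullet> e m) = m * (e l \<bullet> e m)"
      using selfadjD[OF S, of "e l" "e m"] e that by simp
    then show ?thesis using that by simp
  qed
  have inj: "inj_on e E"
    by (rule inj_onI) (metis e(1) orth inner_eq_zero_iff)
  have "independent (e ` E)"
    by (rule pairwise_orthogonal_independent) (auto simp: pairwise_def orthogonal_def dest: e(1), metis orth)
  then have "finite E" using inj independent_imp_finite finite_imageD by blast
  then show ?thesis by (simp add: E_def)
qed

lemma app_exp_eigenvector:
  assumes "app S x = l *\<^sub>R x" shows "app (exp S) x = exp l *\<^sub>R x"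
proof -
  have pow: "app (S ^ n) x = l ^ n *\<^sub>R x" for n
    by (induction n) (simp_all add: assms app.scaleR_right mult.commute)
  have "(\<lambda>n. app (S ^ n /\<^sub>R fact n) x) sums app (exp S) x"
    by (intro bounded_linear.sums[OF app.bounded_linear_left] exp_converges)
  moreover have "(\<lambda>n. (l ^ n /\<^sub>R fact n) *\<^sub>R x) sums (exp l *\<^sub>R x)"
    by (intro bounded_linear.sums[OF bounded_linear_scaleR_left] exp_converges)
  ultimately show ?thesis by (simp add: app.scaleR_left pow sums_unique2)
qed

text \<open>No diagonalisation is required. The trace is the sum of the squared norms of
  \<open>app N b\<close> with \<open>N\<close> the square root of \<open>exp S\<close>, and Bessel's
  inequality for the pair \<open>x\<close>, \<open>y\<close> bounds each of these from
  below.\<close>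

lemma two_exp_le_trace:
  fixes S :: "'a::euclidean_space endo"
  assumes S: "selfadj S" and x: "norm x = 1" "app S x = l *\<^sub>R x" and y: "norm y = 1" "app S y = l *\<^sub>R y"
    and xy: "x \<bullet> y = 0"
  shows "2 * exp l \<le> hs 1 (exp S)"
proof -
  define N where "N = exp ((1 / 2) *\<^sub>R S)"
  have N: "selfadj N" unfolding N_def by (intro selfadj_exp selfadj_scaleR S)
  have Nx: "app N x = exp (l / 2) *\<^sub>R x" "app N y = exp (l / 2) *\<^sub>R y"
    unfolding N_def using app_exp_eigenvector[of "(1 / 2) *\<^sub>R S" x "l / 2"]
      app_exp_eigenvector[of "(1 / 2) *\<^sub>R S" y "l / 2"] x y by (simp_all add: app.scaleR_left)
  have bessel: "(x \<bullet> z)\<^sup>2 + (y \<bullet> z)\<^sup>2 \<le> z \<bullet> z" for z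
  proof -
    have "0 \<le> (z - (x \<bullet> z) *\<^sub>R x - (y \<bullet> z) *\<^sub>R y) \<bullet> (z - (x \<bullet> z) *\<^sub>R x - (y \<bullet> z) *\<^sub>R y)" by simp
    also have "\<dots> = z \<bullet> z - (x \<bullet> z)\<^sup>2 - (y \<bullet> z)\<^sup>2"
    proof -
      have "x \<bullet> x = 1" "y \<bullet> y = 1" "y \<bullet> x = 0" "z \<bullet> x = x \<bullet> z" "z \<bullet> y = y \<bullet> z"
        using x(1) y(1) xy by (simp_all add: dot_square_norm inner_commute)
      then show ?thesis
        using xy by (simp add: inner_diff_left inner_diff_right power2_eq_square algebra_simps)
    qed
    finally show ?thesis by simp
  qed
  have norm_N: "(norm (app N z))\<^sup>2 = (\<Sum>b\<in>Basis. (z \<bullet> app N b)\<^sup>2)" for z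
    unfolding power2_norm_eq_inner euclidean_inner[of "app N z" "app N z"]
    by (simp add: selfadjD[OF N] power2_eq_square)
  have "2 * exp l = (norm (app N x))\<^sup>2 + (norm (app N y))\<^sup>2"
    using x(1) y(1) by (simp add: Nx power2_eq_square exp_add[symmetric])
  also have "\<dots> \<le> (\<Sum>b\<in>Basis. app N b \<bullet> app N b)"
    unfolding norm_N sum.distrib[symmetric] by (intro sum_mono bessel)
  also have "\<dots> = hs 1 (exp S)"
    using hs_exp_half[OF S] by (simp add: N_def hs_def)
  finally show ?thesis .
qed

section \<open>Complex matrices as real endomorphisms\<close>

text \<open>The real inner product on complex vectors is the real part of the Hermitian one, so
  Hermitian matrices become selfadjoint endomorphisms of a real space of twice the
  dimension.\<close>

lift_definition emb :: "complex ^ 'd ^ 'd \<Rightarrow> (complex ^ 'd) endo" is "\<lambda>M. Blinfun ((*v) M)" .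

lemma bounded_linear_matrix_vector_complex: "bounded_linear ((*v) (M :: complex ^ 'd ^ 'd))"
  unfolding linear_conv_bounded_linear[symmetric]
  by (rule linearI)
     (simp add: matrix_vector_right_distrib,
      simp add: vec_eq_iff matrix_vector_mult_def scaleR_sum_right)

lemma app_emb[simp]: "app (emb M) x = M *v x"
  by transfer (simp add: bounded_linear_Blinfun_apply bounded_linear_matrix_vector_complex)

lemma endo_eqI: "(\<And>x. app S x = app T x) \<Longrightarrow> S = T"
  by transfer (rule blinfun_eqI)

lemma bounded_linear_emb: "bounded_linear (emb :: complex ^ 'd ^ 'd \<Rightarrow> _)"
  unfolding linear_conv_bounded_linear[symmetric]
  by (rule linearI; rule endo_eqI)
     (simp add: app.add_left matrix_vector_mult_add_rdistrib,
      simp add: app.scaleR_left vec_eq_iff matrix_vector_mult_def scaleR_sum_right)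

lemma inner_complex_eq: "x \<bullet> y = Re (x * cnj y)"
  by (simp add: inner_complex_def)

lemma selfadj_emb:
  fixes M :: "complex ^ 'd ^ 'd"
  assumes "hermitian M" shows "selfadj (emb M)"
  unfolding selfadj_def
proof (intro allI)
  fix x y :: "complex ^ 'd"
  have "app (emb M) x \<bullet> y = Re (\<Sum>j\<in>UNIV. \<Sum>k\<in>UNIV. M $ j $ k * x $ k * cnj (y $ j))"
    by (simp add: inner_vec_def inner_complex_eq matrix_vector_mult_def sum_distrib_right
        del: complex_cnj_mult)
  also have "\<dots> = Re (\<Sum>k\<in>UNIV. \<Sum>j\<in>UNIV. x $ k * cnj (M $ k $ j * y $ j))"
  proof -
    have "M $ j $ k * x $ k * cnj (y $ j) = x $ k * cnj (M $ k $ j * y $ j)" for j k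
    proof -
      have "cnj (M $ k $ j) = M $ j $ k" using assms unfolding hermitian_def by metis
      then show ?thesis by (simp only: complex_cnj_mult ac_simps)
    qed
    then show ?thesis by (subst sum.swap, intro arg_cong[where f = Re] sum.cong refl)
  qed
  also have "\<dots> = x \<bullet> app (emb M) y"
    by (simp add: inner_vec_def inner_complex_eq matrix_vector_mult_def sum_distrib_left
        del: complex_cnj_mult)
  finally show "app (emb M) x \<bullet> y = x \<bullet> app (emb M) y" .
qed

lemma eigenvalue_of_real_iff:
  "eigenvalue M (complex_of_real l) \<longleftrightarrow> (\<exists>x. x \<noteq> 0 \<and> app (emb M) x = l *\<^sub>R x)"
proof -
  have "complex_of_real l *s x = l *\<^sub>R x" for x :: "complex ^ 'a"
    unfolding vec_eq_iff vector_smult_component vector_scaleR_component by (simp add: scaleR_conv_of_real)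
  then show ?thesis by (simp add: eigenvalue_def)
qed

text \<open>The real trace of \<open>exp (emb M)\<close> counts every eigenvalue of \<open>M\<close> twice, with the eigenvectors
  \<open>x\<close> and \<open>\<i> x\<close>.\<close>

lemma two_exp_lambda_max_le:
  fixes M :: "complex ^ 'd ^ 'd"
  assumes "hermitian M" "0 \<le> \<theta>"
  shows "2 * exp (\<theta> * lambda_max M) \<le> hs 1 (exp (\<theta> *\<^sub>R emb M))"
proof -
  have S: "selfadj (emb M)" by (rule selfadj_emb) fact
  \<comment> \<open>\<open>Max\<close> is meaningful only on a finite nonempty set: finiteness comes
    from orthogonality of eigenvectors, nonemptiness from the Rayleigh quotient.\<close>
  have "lambda_max M \<in> {l. eigenvalue M (complex_of_real l)}"
    unfolding lambda_max_def eigenvalue_of_real_iff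
    by (rule Max_in[OF finite_eigenvalues[OF S]]) (use selfadj_has_eigenvector[OF S] in blast)
  then obtain z where z: "z \<noteq> 0" "app (emb M) z = lambda_max M *\<^sub>R z"
    unfolding eigenvalue_of_real_iff by blast
  define x where "x = z /\<^sub>R norm z"
  define y where "y = (\<chi> j. \<i> * x $ j)"
  have x: "norm x = 1" "M *v x = lambda_max M *\<^sub>R x"
    using z app.scaleR_right[of "emb M" "inverse (norm z)" z] by (simp_all add: x_def)
  have y: "norm y = 1" "M *v y = lambda_max M *\<^sub>R y"
  proof -
    show "norm y = 1" using x(1) by (simp add: y_def norm_vec_def norm_mult)
    have "(M *v y) $ j = \<i> * (M *v x) $ j" for j
      by (simp add: y_def matrix_vector_mult_def sum_distrib_left ac_simps)
    then show "M *v y = lambda_max M *\<^sub>R y"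
      by (simp add: vec_eq_iff x(2)) (simp add: y_def scaleR_conv_of_real ac_simps)
  qed
  \<comment> \<open>The Hermitian product of \<open>x\<close> with its multiple by the imaginary
    unit is purely imaginary, so its real part vanishes.\<close>
  have xy: "x \<bullet> y = 0" by (simp add: y_def inner_vec_def inner_complex_def)
  show ?thesis
    by (rule two_exp_le_trace[of _ x _ y])
       (auto simp: x y xy app.scaleR_left intro!: selfadj_scaleR S)
qed

section \<open>Entrywise integrals and derivatives of matrix functions\<close>

lemma integrable_vec:
  fixes f :: "'a \<Rightarrow> 'b::euclidean_space ^ 'n"
  assumes "\<And>i. integrable M (\<lambda>x. f x $ i)" "f \<in> borel_measurable M"
  shows "integrable M f"
proof (rule Bochner_Integration.integrable_bound)
  show "integrable M (\<lambda>x. \<Sum>i\<in>UNIV. norm (f x $ i))"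
    using assms(1) by (intro Bochner_Integration.integrable_sum integrable_norm)
  have "norm (f x) \<le> (\<Sum>i\<in>UNIV. norm (f x $ i))" for x
    unfolding norm_vec_def by (rule L2_set_le_sum) simp
  then show "AE x in M. norm (f x) \<le> norm (\<Sum>i\<in>UNIV. norm (f x $ i))"
    by (simp add: sum_nonneg)
qed fact

lemma has_derivative_vec:
  fixes f :: "'a::real_normed_vector \<Rightarrow> 'b::real_normed_vector ^ 'n"
  assumes "\<And>i. ((\<lambda>x. f x $ i) has_derivative (\<lambda>h. f' h $ i)) (at x)"
  shows "(f has_derivative f') (at x)"
proof (rule has_derivativeI)
  have lin: "bounded_linear (\<lambda>h. f' h $ i)" for i by (rule has_derivative_bounded_linear[OF assms])
  show "bounded_linear f'"
  proof -
    obtain K where K: "\<And>i h. norm (f' h $ i) \<le> norm h * K i"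
      using bounded_linear.bounded[OF lin] by metis
    show ?thesis
    proof (rule bounded_linear_intro[where K = "\<Sum>i\<in>UNIV. K i"])
      show "f' (g + h) = f' g + f' h" for g h
        by (simp add: vec_eq_iff linear_add[OF bounded_linear.linear[OF lin]])
      show "f' (r *\<^sub>R h) = r *\<^sub>R f' h" for r h
        by (simp add: vec_eq_iff linear_cmul[OF bounded_linear.linear[OF lin]])
      show "norm (f' h) \<le> norm h * (\<Sum>i\<in>UNIV. K i)" for h
        unfolding norm_vec_def[of "f' h"] sum_distrib_left
        by (rule order_trans[OF L2_set_le_sum]) (auto intro: sum_mono K)
    qed
  qed
  show "((\<lambda>y. (f y - f x - f' (y - x)) /\<^sub>R norm (y - x)) \<longlongrightarrow> 0) (at x)"
  proof (rule vec_tendstoI)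
    fix i
    show "((\<lambda>y. ((f y - f x - f' (y - x)) /\<^sub>R norm (y - x)) $ i) \<longlongrightarrow> 0 $ i) (at x)"
      using assms[of i] unfolding has_derivative_at_within by simp
  qed
qed

lemma partial_deriv_eq:
  assumes "(g has_derivative g') (at x)"
  shows "partial_deriv i g x = g' (axis i 1)"
proof -
  have 1: "((\<lambda>s::real. x + s *\<^sub>R axis i 1) has_derivative (\<lambda>h. h *\<^sub>R axis i 1)) (at 0)"
    by (auto intro!: derivative_eq_intros)
  have 2: "(g has_derivative g') (at (x + 0 *\<^sub>R axis i 1))" using assms by simp
  from has_derivative_compose[OF 1 2] have "((\<lambda>s. g (x + s *\<^sub>R axis i 1)) has_vector_derivative g' (axis i 1)) (at 0)"
    by (simp add: has_vector_derivative_def linear_cmul[OF has_derivative_linear[OF assms]])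
  then show ?thesis unfolding partial_deriv_def by (rule vector_derivative_at)
qed

lemma op_norm_bound: "norm (M *v x) \<le> op_norm M * norm x"
  unfolding op_norm_def by (rule onorm[OF bounded_linear_matrix_vector_complex])

lemma op_norm_nonneg: "0 \<le> op_norm M"
  unfolding op_norm_def by (rule onorm_pos_le[OF bounded_linear_matrix_vector_complex])

lemma hermitian_mat_expectation:
  assumes "\<And>x. hermitian (f x)" shows "hermitian (mat_expectation M f)"
proof -
  have "(\<integral>x. f x $ j $ k \<partial>M) = cnj (\<integral>x. f x $ k $ j \<partial>M)" for j k
  proof -
    have "(\<integral>x. f x $ j $ k \<partial>M) = (\<integral>x. cnj (f x $ k $ j) \<partial>M)"
      by (rule Bochner_Integration.integral_cong[OF refl]) (rule assms[unfolded hermitian_def, rule_format])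
    also have "\<dots> = cnj (\<integral>x. f x $ k $ j \<partial>M)"
      by (rule Bochner_Integration.integral_cnj)
    finally show ?thesis .
  qed
  then show ?thesis
    unfolding hermitian_def mat_expectation_def vec_lambda_beta by (intro allI)
qed

lemma hermitian_diff: "hermitian A \<Longrightarrow> hermitian B \<Longrightarrow> hermitian (A - B)"
  unfolding hermitian_def vector_minus_component complex_cnj_diff
  by (intro allI arg_cong2[of _ _ _ _ "(-)"]) blast+

text \<open>Links the operator norm in the variance parameter to the quadratic form in the locale:
  for selfadjoint \<open>A i\<close> the squared norm is the form of
  \<open>A i ** A i\<close>.\<close>

lemma sum_norm_selfadj_emb:
  assumes "\<And>i. i \<in> I \<Longrightarrow> selfadj (emb (A i))"
  shows "(\<Sum>i\<in>I. (norm (A i *v z))\<^sup>2) \<le> op_norm (\<Sum>i\<in>I. A i ** A i) * (norm z)\<^sup>2"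
proof -
  have "(\<Sum>i\<in>I. (norm (A i *v z))\<^sup>2) = (\<Sum>i\<in>I. ((A i ** A i) *v z) \<bullet> z)"
  proof (rule sum.cong[OF refl])
    fix i assume "i \<in> I"
    from selfadjD[OF assms[OF this], of "A i *v z" z]
    show "(norm (A i *v z))\<^sup>2 = ((A i ** A i) *v z) \<bullet> z"
      by (simp add: power2_norm_eq_inner matrix_vector_mul_assoc)
  qed
  also have "\<dots> = ((\<Sum>i\<in>I. A i ** A i) *v z) \<bullet> z"
    using linear_sum[OF bounded_linear.linear[OF bounded_linear_emb], of "\<lambda>i. A i ** A i" I]
    by (simp add: inner_sum_left[symmetric] app.sum_left flip: app_emb)
  also have "\<dots> \<le> norm ((\<Sum>i\<in>I. A i ** A i) *v z) * norm z" by (rule norm_cauchy_schwarz)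
  also have "\<dots> \<le> (op_norm (\<Sum>i\<in>I. A i ** A i) * norm z) * norm z"
    by (intro mult_right_mono op_norm_bound) simp
  finally show ?thesis by (simp add: power2_eq_square mult.assoc)
qed

section \<open>The tail bound\<close>

text \<open>Here \<open>v\<close> is any positive upper bound rather than the supremum, so that a
  vanishing variance parameter can be approached from above.\<close>

lemma gauss_lambda_max_tail:
  fixes f :: "real ^ 'n \<Rightarrow> complex ^ 'd ^ 'd"
  assumes herm: "\<And>x. hermitian (f x)"
    and smooth: "\<And>j k. smooth (\<lambda>x. f x $ j $ k)"
    and int: "\<And>j k. integrable gauss (\<lambda>x. f x $ j $ k)"
    and v: "\<And>x. op_norm (\<Sum>i\<in>UNIV. mat_partial_deriv i f x ** mat_partial_deriv i f x) \<le> v" "0 < v"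
    and t: "0 \<le> t"
  shows "measure gauss {x. t \<le> lambda_max (f x - mat_expectation gauss f)}
    \<le> real CARD('d) * exp (- (t\<^sup>2 / (2 * v)))"
proof -
  let ?M = "mat_expectation gauss f"
  have C1: "C_k (Suc 0) (\<lambda>x. f x $ j $ k)" for j k
    using smooth[of j k] unfolding smooth_def by blast
  define D where "D j k x = frechet_derivative (\<lambda>x. f x $ j $ k) (at x)" for j k x
  have D: "((\<lambda>x. f x $ j $ k) has_derivative D j k x) (at x)" for j k x
    using C1[of j k] unfolding D_def by (simp add: frechet_derivative_works[symmetric])
  have D_partial: "D j k x (axis i 1) = partial_deriv i (\<lambda>x. f x $ j $ k) x" for i j k x
    using partial_deriv_eq[OF D] by simp
  define f' where "f' x h = (\<chi> j k. D j k x h)" for x h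
  have f'_partial: "f' x (axis i 1) = mat_partial_deriv i f x" for x i
    by (simp add: f'_def mat_partial_deriv_def D_partial vec_eq_iff)
  have f': "(f has_derivative f' x) (at x)" for x
    by (intro has_derivative_vec) (simp add: f'_def D)
  define F where "F x = emb (f x - ?M)" for x
  have herm_diff: "hermitian (f x - ?M)" for x
    by (intro hermitian_diff herm hermitian_mat_expectation)
  have der: "(F has_derivative (\<lambda>h. emb (f' x h))) (at x)" for x
    unfolding F_def
    by (rule bounded_linear.has_derivative[OF bounded_linear_emb])
       (auto intro!: derivative_eq_intros f')
  have sa: "selfadj (F x)" for x
    unfolding F_def by (rule selfadj_emb[OF herm_diff])
  have sa': "selfadj (emb (f' x h))" for x h
    using selfadj_derivative[OF der sa] .
  interpret lipschitz_endo_fun F "\<lambda>x h. emb (f' x h)" v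
  proof
    show "(F has_derivative (\<lambda>h. emb (f' x h))) (at x)" for x by (rule der)
    show "selfadj (F x)" for x by (rule sa)
    fix i :: "real ^ 'n" assume "i \<in> Basis"
    then obtain i' where i': "i = axis i' 1" by (auto simp: Basis_vec_def)
    have "continuous_on UNIV (\<lambda>x. D j k x i)" for j k
      using C1[of j k] unfolding i' D_partial by simp
    then show "continuous_on UNIV (\<lambda>x. emb (f' x i))"
      unfolding f'_def
      by (intro bounded_linear.continuous_on[OF bounded_linear_emb] continuous_on_vec_lambda)
  next
    fix x :: "real ^ 'n" and z
    have "(\<Sum>i\<in>Basis. (norm (app (emb (f' x i)) z))\<^sup>2)
        = (\<Sum>i\<in>UNIV. (norm (mat_partial_deriv i f x *v z))\<^sup>2)"
      by (simp add: sum_Basis_vec f'_partial)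
    also have "\<dots> \<le> op_norm (\<Sum>i\<in>UNIV. mat_partial_deriv i f x ** mat_partial_deriv i f x) * (norm z)\<^sup>2"
      by (rule sum_norm_selfadj_emb) (metis f'_partial sa')
    also have "\<dots> \<le> v * (norm z)\<^sup>2" by (intro mult_right_mono v) simp
    finally show "(\<Sum>i\<in>Basis. (norm (app (emb (f' x i)) z))\<^sup>2) \<le> v * (norm z)\<^sup>2" .
  qed
  have "continuous_on UNIV f"
    using f' by (meson continuous_at_imp_continuous_on has_derivative_continuous)
  then have f_meas: "f \<in> borel_measurable borel" by (rule borel_measurable_continuous_onI)
  have f_meas': "(\<lambda>x. f x $ j) \<in> borel_measurable borel" for j
    using \<open>continuous_on UNIV f\<close> by (intro borel_measurable_continuous_onI continuous_intros)
  have f_int': "integrable gauss (\<lambda>x. f x $ j)" for j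
    using f_meas' by (intro integrable_vec int) simp
  have f_int: "integrable gauss f"
    using f_meas by (intro integrable_vec f_int') simp
  have M: "(\<integral>x. f x \<partial>gauss) = ?M"
    by (simp add: vec_eq_iff mat_expectation_def
      integral_bounded_linear[OF bounded_linear_vec_nth f_int, symmetric]
      integral_bounded_linear[OF bounded_linear_vec_nth f_int', symmetric])
  have mean: "(\<integral>x. app (F x) b \<bullet> c \<partial>gauss) = 0" for b c
  proof -
    have lin: "bounded_linear (\<lambda>A. app (emb A) b \<bullet> c)"
      by (rule bounded_linear_compose[OF bounded_linear_app_inner bounded_linear_emb])
    have "(\<integral>x. app (F x) b \<bullet> c \<partial>gauss) = app (emb (\<integral>x. f x - ?M \<partial>gauss)) b \<bullet> c"
      unfolding F_def by (rule integral_bounded_linear[OF lin]) (simp add: f_int)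
    also have "(\<integral>x. f x - ?M \<partial>gauss) = 0"
      using f_int by (simp add: M gauss.prob_space[unfolded space_gauss])
    finally show ?thesis by (simp del: app_emb add: linear_0[OF bounded_linear.linear[OF bounded_linear_emb]] app.zero_left)
  qed
  \<comment> \<open>The minimiser of \<theta>^2 v / 2 - \<theta> t.\<close>
  define \<theta> where "\<theta> = t / v"
  have \<theta>: "0 \<le> \<theta>" using t v(2) by (simp add: \<theta>_def)
  let ?tr = "\<lambda>x. hs 1 (exp (\<theta> *\<^sub>R F x))"
  have tr_ge: "2 * exp (\<theta> * lambda_max (f x - ?M)) \<le> ?tr x" for x
    unfolding F_def by (rule two_exp_lambda_max_le[OF herm_diff \<theta>])
  \<comment> \<open>The event is enclosed in one described by the trace, a continuous function of
    \<open>x\<close>; monotonicity of the measure asks for measurability of this larger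
    event.\<close>
  have "measure gauss {x. t \<le> lambda_max (f x - ?M)} \<le> measure gauss {x\<in>space gauss. 2 * exp (\<theta> * t) \<le> ?tr x}"
  proof (rule gauss.finite_measure_mono)
    show "{x. t \<le> lambda_max (f x - ?M)} \<subseteq> {x\<in>space gauss. 2 * exp (\<theta> * t) \<le> ?tr x}"
    proof safe
      fix x assume "t \<le> lambda_max (f x - ?M)"
      then have "2 * exp (\<theta> * t) \<le> 2 * exp (\<theta> * lambda_max (f x - ?M))"
        using \<theta> by (simp add: mult_left_mono)
      then show "2 * exp (\<theta> * t) \<le> ?tr x" using tr_ge[of x] by linarith
    qed simp
    have [measurable]: "?tr \<in> borel_measurable borel"
      by (intro borel_measurable_continuous_onI continuous_trace)
    show "{x\<in>space gauss. 2 * exp (\<theta> * t) \<le> ?tr x} \<in> sets gauss" by measurable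
  qed
  also have "\<dots> \<le> L \<theta> / (2 * exp (\<theta> * t))"
    unfolding L_def
  proof (rule integral_Markov_inequality_measure[OF integrable_trace sets.empty_sets])
    have "0 \<le> ?tr x" for x using tr_ge[of x] by (smt (verit) exp_gt_zero)
    then show "AE x in gauss. 0 \<le> ?tr x" by simp
  qed simp
  also have "\<dots> \<le> real DIM(complex ^ 'd) * exp (\<theta>\<^sup>2 * v / 2) / (2 * exp (\<theta> * t))"
    using L_le[OF mean \<theta>] by (intro divide_right_mono) auto
  \<comment> \<open>The real dimension is \<open>2 * CARD('d)\<close>, and its factor 2 cancels
    against the one in the Markov threshold.\<close>
  also have "\<dots> = real CARD('d) * exp (\<theta>\<^sup>2 * v / 2 - \<theta> * t)"
    by (simp add: exp_diff)
  also have "\<theta>\<^sup>2 * v / 2 - \<theta> * t = - (t\<^sup>2 / (2 * v))"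
    using v(2) by (simp add: \<theta>_def power2_eq_square field_simps)
  finally show ?thesis .
qed

theorem theorem1p3:
  fixes f :: "real ^ 'n \<Rightarrow> complex ^ 'd ^ 'd" and t :: real
  assumes "\<And>x. hermitian (f x)"
    and "\<And>j k. smooth (\<lambda>x. f x $ j $ k)"
    and "\<And>j k. in_L2 std_gaussian (\<lambda>x. f x $ j $ k)"
    and "t \<ge> 0"
  shows "measure std_gaussian
           {x \<in> space std_gaussian. lambda_max (f x - mat_expectation std_gaussian f) \<ge> t}
         \<le> tail_bound CARD('d) (variance_param f) t"
proof -
  let ?S = "\<lambda>x. op_norm (\<Sum>i\<in>UNIV. mat_partial_deriv i f x ** mat_partial_deriv i f x)"
  let ?P = "measure std_gaussian
           {x \<in> space std_gaussian. lambda_max (f x - mat_expectation std_gaussian f) \<ge> t}"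
  define d where "d = real CARD('d)"
  have d: "1 \<le> d" by (simp add: d_def Suc_leI)
  have int: "integrable gauss (\<lambda>x. f x $ j $ k)" for j k
  proof (rule gauss.square_integrable_imp_integrable)
    have m: "(\<lambda>x. f x $ j $ k) \<in> borel_measurable gauss" "integrable gauss (\<lambda>x. (cmod (f x $ j $ k))\<^sup>2)"
      using assms(3)[of j k] by (simp_all add: in_L2_def std_gaussian_eq_gauss)
    then show "(\<lambda>x. f x $ j $ k) \<in> borel_measurable gauss" by simp
    show "integrable gauss (\<lambda>x. (f x $ j $ k)\<^sup>2)"
      by (rule Bochner_Integration.integrable_bound[OF m(2)]) (use m(1) in \<open>auto simp: norm_power\<close>)
  qed
  have P: "?P \<le> 1" unfolding std_gaussian_eq_gauss by simp
  have v_nonneg: "0 \<le> variance_param f"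
    unfolding variance_param_def by (rule SUP_upper2[of 0]) (auto simp: op_norm_nonneg)
  show ?thesis
  proof (cases "variance_param f = \<infinity>")
    case True
    then show ?thesis using order_trans[OF P d] by (simp add: tail_bound_def d_def)
  next
    case False
    then obtain r where r: "variance_param f = ereal r" "0 \<le> r"
      using v_nonneg by (cases "variance_param f") auto
    have S: "?S x \<le> r" for x
      using SUP_upper[of x UNIV "\<lambda>x. ereal (?S x)"] r(1) by (simp add: variance_param_def)
    have tail: "?P \<le> d * exp (- (t\<^sup>2 / (2 * v)))" if "r \<le> v" "0 < v" for v
      using gauss_lambda_max_tail[OF assms(1,2) int _ that(2) assms(4)] S that(1)
      by (simp add: std_gaussian_eq_gauss d_def) (meson order_trans)
    show ?thesis
    proof (cases "r = 0")
      case True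
      show ?thesis
      proof (cases "t > 0")
        case t: True
        \<comment> \<open>With variance parameter 0 every positive \<open>v\<close> is admissible.
          The inequality exp(- y) \<le> 1 / y weakens the tail to a bound linear in
          \<open>v\<close>, whose limit at 0 is immediate.\<close>
        have "?P \<le> d * (2 * v / t\<^sup>2)" if v: "0 < v" for v
        proof -
          have "t\<^sup>2 / (2 * v) \<le> exp (t\<^sup>2 / (2 * v))"
            using exp_ge_add_one_self[of "t\<^sup>2 / (2 * v)"] by linarith
          then have "exp (- (t\<^sup>2 / (2 * v))) \<le> inverse (t\<^sup>2 / (2 * v))"
            unfolding exp_minus using t v by (intro le_imp_inverse_le) auto
          also have "\<dots> = 2 * v / t\<^sup>2" by simp
          finally have "d * exp (- (t\<^sup>2 / (2 * v))) \<le> d * (2 * v / t\<^sup>2)"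
            using d by (intro mult_left_mono) auto
          then show ?thesis using tail[of v] True v by simp
        qed
        then have "\<forall>\<^sub>F v in at_right 0. ?P \<le> d * (2 * v / t\<^sup>2)"
          by (auto simp: eventually_at_right_field intro: exI[of _ 1])
        moreover have "((\<lambda>v. d * (2 * v / t\<^sup>2)) \<longlongrightarrow> d * (2 * 0 / t\<^sup>2)) (at_right 0)"
          using t by (intro tendsto_intros) simp
        ultimately have "?P \<le> 0"
          using tendsto_lowerbound[of "\<lambda>v. d * (2 * v / t\<^sup>2)" _ "at_right 0"] by simp
        then show ?thesis using True t r by (simp add: tail_bound_def)
      next
        case False
        then show ?thesis using True order_trans[OF P d] r by (simp add: tail_bound_def d_def)
      qed
    next
      case False
      then have "0 < r" using r by simp
      then have "t\<^sup>2 / (2 * r + t * sqrt (2 * r)) \<le> t\<^sup>2 / (2 * r)"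
        using assms(4) by (intro divide_left_mono) (auto intro!: mult_pos_pos add_pos_nonneg)
      then have "d * exp (- (t\<^sup>2 / (2 * r))) \<le> d * exp (- (t\<^sup>2 / (2 * r + t * sqrt (2 * r))))"
        using d by simp
      then have "?P \<le> d * exp (- (t\<^sup>2 / (2 * r + t * sqrt (2 * r))))"
        using tail[of r] \<open>0 < r\<close> by linarith
      then show ?thesis using \<open>0 < r\<close> r by (simp add: tail_bound_def d_def)
    qed
  qed
qed

end
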